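(* Fix $n\in\mathbb{N}$ and complex parameters $a_1,\dots,a_{n-1},b_1,\dots,b_{n-1}$ of modulus strictly less than $1$. The family of symmetric polynomials $\{\mathsf f_\lambda(x_1,\dots,x_n|a_1,\dots,a_{n-1};b_1,\dots,b_{n-1})\}_{\lambda\in\mathbb{Y}_n}$ is a linear basis of the space $\mathsf{Sym}_n$ of symmetric polynomials in $n$ variables $x_1,\dots,x_n$ (over $\mathbb{C}$).
   Context: Let $q\in\mathbb{C}$ with $|q|<1$, and $(z;q)_k=\prod_{i=0}^{k-1}(1-zq^i)$ for $k\in\mathbb{Z}_{\ge0}$. $\mathbb{Y}_n$ is the set of integer partitions $\lambda=(\lambda_1\ge\dots\ge\lambda_n\ge0)$ with at most $n$ nonzero parts, with $\lambda_i=0$ for $i>n$; $|\lambda|=\sum_i\lambda_i$. For partitions, $\mu\preceq\lambda$ means $\lambda_i\ge\mu_i\ge\lambda_{i+1}$ for all $i\ge1$. Spin $q$-Whittaker polynomials: let $c_1,\dots,c_n,d_1,\dots,d_n$ be complex parameters of modulus $<1$. For $\lambda\in\mathbb{Y}_n$, $\mu\in\mathbb{Y}_{n-1}$ set $$\mathbb{F}_{\lambda/\mu}(x|c_1,\dots,c_n;d_1,\dots,d_n)=\mathbf 1_{\mu\preceq\lambda}\,x^{|\lambda|-|\mu|}\prod_{r=1}^n\frac{(c_r/x;q)_{\lambda_r-\mu_r}(xd_r;q)_{\mu_r-\lambda_{r+1}}(q;q)_{\lambda_r-\lambda_{r+1}}}{(q;q)_{\lambda_r-\mu_r}(q;q)_{\mu_r-\lambda_{r+1}}(c_rd_r;q)_{\lambda_r-\lambda_{r+1}}}.$$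 Define recursively, starting from $\mathbb{F}_\varnothing=1$ in zero variables, $$\mathbb{F}_\lambda(x_1,\dots,x_n|c_1,\dots,c_n;d_1,\dots,d_n)=\sum_{\mu\in\mathbb{Y}_{n-1},\,\mu\preceq\lambda}\mathbb{F}_\mu(x_1,\dots,x_{n-1}|c_2,\dots,c_n;d_1,\dots,d_{n-1})\,\mathbb{F}_{\lambda/\mu}(x_n|c_1,\dots,c_n;d_1,\dots,d_n).$$ These are polynomials, known to be symmetric in $x_1,\dots,x_n$. Set $$\mathsf f_\lambda(x_1,\dots,x_n|c_1,\dots,c_{n-1};d_1,\dots,d_{n-1})=\mathbb{F}_\lambda(x_1,\dots,x_n|c_1,\dots,c_{n-1},0;d_1,\dots,d_n),$$ which does not depend on $d_n$. *)

theory Defs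
  imports Complex_Main "HOL-Library.Poly_Mapping" "HOL-Combinatorics.Permutations"
begin

text \<open>
  Sequences of variables, parameters and parts are indexed from \<open>0\<close>: \<open>X i\<close>, \<open>c i\<close>, \<open>d i\<close> and
  \<open>lam i\<close> stand for the mathematical \<open>x\<^sub>i\<^sub>+\<^sub>1\<close>, \<open>c\<^sub>i\<^sub>+\<^sub>1\<close>, \<open>d\<^sub>i\<^sub>+\<^sub>1\<close> and \<open>\<lambda>\<^sub>i\<^sub>+\<^sub>1\<close>.

  Since the defining formula of the spin q-Whittaker polynomials contains \<open>c / x\<close>, everything takes
  place in the ring of complex Laurent polynomials; the polynomials are the elements all of whose
  exponents are nonnegative.
\<close>

type_synonym laurent = "(nat \<Rightarrow>\<^sub>0 int) \<Rightarrow>\<^sub>0 complex"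

definition Const :: "complex \<Rightarrow> laurent" where
  "Const c = Poly_Mapping.single 0 c"

definition X :: "nat \<Rightarrow> laurent" where
  "X i = Poly_Mapping.single (Poly_Mapping.single i 1) 1"

definition Xinv :: "nat \<Rightarrow> laurent" where
  "Xinv i = Poly_Mapping.single (Poly_Mapping.single i (- 1)) 1"

lemma X_mult_Xinv: "X i * Xinv i = 1"
  by (simp add: X_def Xinv_def mult_single flip: single_add)

definition lscale :: "complex \<Rightarrow> laurent \<Rightarrow> laurent" where
  "lscale c p = Const c * p"

interpretation laurent: vector_space lscale
  by standard
    (simp_all add: lscale_def Const_def algebra_simps single_add mult_single
      flip: mult.assoc)

definition polynomials :: "nat \<Rightarrow> laurent set" where
  "polynomials n =
    {p. \<forall>m \<in> Poly_Mapping.keys p.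
          Poly_Mapping.keys m \<subseteq> {..<n} \<and> (\<forall>i. Poly_Mapping.lookup m i \<ge> 0)}"

text \<open>For \<open>\<pi>\<close> a permutation, \<open>map_key \<pi> m\<close> is the exponent vector \<open>i \<mapsto> m (\<pi> i)\<close>.\<close>

definition Sym :: "nat \<Rightarrow> laurent set" where
  "Sym n =
    {p \<in> polynomials n. \<forall>\<pi>. \<pi> permutes {..<n} \<longrightarrow>
       (\<forall>m. Poly_Mapping.lookup p (Poly_Mapping.map_key \<pi> m) = Poly_Mapping.lookup p m)}"

definition qpoch :: "'a::comm_ring_1 \<Rightarrow> 'a \<Rightarrow> nat \<Rightarrow> 'a" where
  "qpoch z q k = (\<Prod>i<k. 1 - z * q ^ i)"

definition Y :: "nat \<Rightarrow> (nat \<Rightarrow> nat) set" where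
  "Y n = {lam. antimono lam \<and> (\<forall>i\<ge>n. lam i = 0)}"

definition interlaces :: "(nat \<Rightarrow> nat) \<Rightarrow> (nat \<Rightarrow> nat) \<Rightarrow> bool" (infix "\<preceq>" 50) where
  "\<mu> \<preceq> lam \<longleftrightarrow> (\<forall>i. \<mu> i \<le> lam i \<and> lam (Suc i) \<le> \<mu> i)"

text \<open>
  \<open>spinW_skew q n c d lam \<mu> v\<close> is \<open>\<F>\<^sub>\<lambda>\<^sub>/\<^sub>\<mu>(x | c\<^sub>1,\<dots>,c\<^sub>n; d\<^sub>1,\<dots>,d\<^sub>n)\<close> with \<open>x\<close> the variable \<open>X v\<close>, for
  \<open>lam \<in> Y n\<close> and \<open>\<mu> \<in> Y (n - 1)\<close>.
\<close>

definition spinW_skew ::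
  "complex \<Rightarrow> nat \<Rightarrow> (nat \<Rightarrow> complex) \<Rightarrow> (nat \<Rightarrow> complex) \<Rightarrow> (nat \<Rightarrow> nat) \<Rightarrow> (nat \<Rightarrow> nat)
    \<Rightarrow> nat \<Rightarrow> laurent" where
  "spinW_skew q n c d lam \<mu> v =
    (if \<mu> \<preceq> lam then
       X v ^ ((\<Sum>i<n. lam i) - (\<Sum>i<n. \<mu> i)) *
       (\<Prod>r<n.
          qpoch (Const (c r) * Xinv v) (Const q) (lam r - \<mu> r) *
          qpoch (X v * Const (d r)) (Const q) (\<mu> r - lam (Suc r)) *
          Const (qpoch q q (lam r - lam (Suc r)) /
                 (qpoch q q (lam r - \<mu> r) * qpoch q q (\<mu> r - lam (Suc r)) *
                  qpoch (c r * d r) q (lam r - lam (Suc r)))))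
     else 0)"

fun spinW ::
  "complex \<Rightarrow> nat \<Rightarrow> (nat \<Rightarrow> complex) \<Rightarrow> (nat \<Rightarrow> complex) \<Rightarrow> (nat \<Rightarrow> nat) \<Rightarrow> laurent" where
  "spinW q 0 c d lam = 1"
| "spinW q (Suc n) c d lam =
    (\<Sum>\<mu> \<in> {\<mu> \<in> Y n. \<mu> \<preceq> lam}.
       spinW q n (\<lambda>i. c (Suc i)) d \<mu> * spinW_skew q (Suc n) c d lam \<mu> n)"

lemma finite_interlacing: "finite {\<mu> \<in> Y n. \<mu> \<preceq> lam}"
proof (rule finite_subset)
  show "{\<mu> \<in> Y n. \<mu> \<preceq> lam} \<subseteq>
      {\<mu>. \<forall>i. (i \<in> {..<n} \<longrightarrow> \<mu> i \<in> {..Max (lam ` {..<n})}) \<and> (i \<notin> {..<n} \<longrightarrow> \<mu> i = 0)}"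
    by (auto simp: Y_def interlaces_def intro: order_trans)
qed (rule finite_set_of_finite_funs; simp)

text \<open>
  The polynomials \<open>\<f>\<^sub>\<lambda>\<close>: only \<open>a 0, \<dots>, a (n - 2)\<close> and \<open>b 0, \<dots>, b (n - 2)\<close> matter.  The entry
  \<open>b (n - 1)\<close> plays the role of the irrelevant \<open>d\<^sub>n\<close>; see \<open>spinf_cong\<close>.
\<close>

definition spinf ::
  "complex \<Rightarrow> nat \<Rightarrow> (nat \<Rightarrow> complex) \<Rightarrow> (nat \<Rightarrow> complex) \<Rightarrow> (nat \<Rightarrow> nat) \<Rightarrow> laurent" where
  "spinf q n a b lam = spinW q n (a(n - 1 := 0)) b lam"

lemma qpoch_0 [simp]: "qpoch 0 q k = 1"
  by (simp add: qpoch_def)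

lemma spinW_cong:
  assumes "\<And>i. i < n \<Longrightarrow> c i = c' i" "\<And>i. i < n \<Longrightarrow> d i = d' i"
  shows "spinW q n c d lam = spinW q n c' d' lam"
  using assms
proof (induction n arbitrary: c c' lam)
  case (Suc n)
  have "spinW q n (\<lambda>i. c (Suc i)) d \<mu> = spinW q n (\<lambda>i. c' (Suc i)) d' \<mu>" for \<mu>
    by (rule Suc.IH) (simp_all add: Suc.prems)
  moreover have "spinW_skew q (Suc n) c d lam \<mu> n = spinW_skew q (Suc n) c' d' lam \<mu> n" for \<mu>
    unfolding spinW_skew_def
    by (rule if_cong refl arg_cong2[where f = times] prod.cong)+ (simp_all add: Suc.prems)
  ultimately show ?case by simp
qed simp

lemma spinf_cong:
  assumes "lam \<in> Y n" "\<And>i. i < n - 1 \<Longrightarrow> a i = a' i" "\<And>i. i < n - 1 \<Longrightarrow> b i = b' i"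
  shows "spinf q n a b lam = spinf q n a' b' lam"
proof (cases n)
  case (Suc m)
  let ?c = "a(m := 0)" and ?c' = "a'(m := 0)"
  have c: "?c i = ?c' i" if "i < Suc m" for i
    using that assms(2) Suc by simp
  have "spinW q m (\<lambda>i. ?c (Suc i)) b \<mu> = spinW q m (\<lambda>i. ?c' (Suc i)) b' \<mu>" for \<mu>
    by (rule spinW_cong) (use c assms(3) Suc in auto)
  moreover have "spinW_skew q (Suc m) ?c b lam \<mu> m = spinW_skew q (Suc m) ?c' b' lam \<mu> m"
    if "\<mu> \<in> Y m" for \<mu>
  proof -
    have 0: "\<mu> m = 0" "lam (Suc m) = 0"
      using that assms(1) Suc by (auto simp: Y_def)
    have prod_eq: "(\<Prod>r<Suc m. f r) = (\<Prod>r<Suc m. g r)"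
      if "\<And>r. r < m \<Longrightarrow> f r = g r" "f m = g m" for f g :: "nat \<Rightarrow> laurent"
      using that by simp
    show ?thesis
      unfolding spinW_skew_def
      by (intro if_cong refl arg_cong2[where f = times] prod_eq)
        (use 0 assms(2,3) Suc in \<open>auto simp: Const_def qpoch_def\<close>)
  qed
  ultimately show ?thesis
    unfolding Suc spinf_def spinW.simps diff_Suc_1
    by (intro sum.cong refl) simp
qed (simp add: spinf_def)

end

theory Submission
  imports Defs
begin

text \<open>
  Two things have to be shown: that the polynomials are symmetric, and that they form a basis.

  Symmetry.  It suffices to exchange two neighbouring variables, that is, to exchange the
  variables of two consecutive steps \<open>\<nu> \<preceq> \<mu> \<preceq> \<lambda>\<close> of the branching rule after summing over \<open>\<mu>\<close>.
  That sum is a one-dimensional chain: its summand is a product over \<open>r\<close> of weights that involve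
  only \<open>\<mu>\<^sub>r\<close> and \<open>\<mu>\<^sub>r\<^sub>+\<^sub>1\<close>, so it is computed by a product of transfer matrices, one per column
  (\<open>two_rows_eq_transfer\<close>).  Let \<open>E\<close> be the lower triangular matrix with entries
  \<open>(x - y)(x - y q) \<cdots> (x - y q\<^sup>s\<^sup>-\<^sup>1) / (q;q)\<^sub>s\<close> at distance \<open>s\<close> from the diagonal.  Every column matrix
  \<open>W\<close> satisfies \<open>W(x,y) E = E W(y,x)\<close> (\<open>column_weight_exchange\<close>), a Yang-Baxter type relation.
  At the right end of the chain the only value of the part is \<open>0\<close>, where \<open>E\<close> acts trivially, so \<open>E\<close> can be
  inserted there for free.  Pulled through all columns it meets the weight of the first part,
  which absorbs it by the q-binomial theorem and turns into the same weight with the variables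
  exchanged (\<open>transfer_symmetric\<close>).  The relation for a single column, written out, is an identity
  between two terminating balanced \<open>\<^sub>4\<phi>\<^sub>3\<close> series.  Sears' transformation takes each of the two to the
  same third sum (\<open>exchange_sum_eq\<close>, \<open>sears_sum_symmetric\<close>), and Sears' transformation in turn
  is two applications of the q-Pfaff-Saalschuetz summation.

  Basis.  The argument is an induction on the number of variables that uses two special features
  of the polynomials \<open>\<f>\<^sub>\<lambda>\<close>, for which the last of the parameters \<open>c\<close> vanishes.
  Adding \<open>1\<close> to all \<open>n\<close> parts of \<open>\<lambda>\<close> multiplies \<open>\<f>\<^sub>\<lambda>\<close> by \<open>x\<^sub>1 \<cdots> x\<^sub>n\<close> (\<open>spinW_raise_parts\<close>).
  Putting \<open>x\<^sub>n = 0\<close> kills \<open>\<f>\<^sub>\<lambda>\<close> if \<open>\<lambda>\<^sub>n > 0\<close>, and otherwise turns it into a combination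
  of the polynomials \<open>\<f>\<^sub>\<mu>\<close> in \<open>n - 1\<close> variables with \<open>\<mu> \<preceq> \<lambda>\<close> in which \<open>\<f>\<^sub>\<lambda>\<close> itself has a nonzero
  coefficient (\<open>zero_at_spinW\<close>, \<open>skew_at_0_diag\<close>).  By the induction hypothesis and triangularity,
  the polynomials with \<open>\<lambda>\<^sub>n = 0\<close> restrict to a basis of the symmetric polynomials in \<open>n - 1\<close>
  variables.  A symmetric polynomial that vanishes at \<open>x\<^sub>n = 0\<close> is \<open>x\<^sub>1 \<cdots> x\<^sub>n\<close> times a symmetric
  polynomial of smaller degree in each variable, to which the argument applies again.  Since
  \<open>\<f>\<^sub>\<lambda>\<close> has degree at most \<open>\<lambda>\<^sub>1\<close> in each variable, the bound on the degrees is never lost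
  (\<open>Sym_le_subset_span\<close>), and the descent ends.
\<close>

section \<open>Saalschuetz and Sears identities\<close>

locale q_calculus =
  fixes q :: "'a::field"
  assumes power_q_neq_1: "k > 0 \<Longrightarrow> q ^ k \<noteq> 1"
begin

text \<open>
  Homogeneous form of the shifted factorial: \<open>x\<^sup>k (y/x;q)\<^sub>k\<close> without the division by \<open>x\<close>.  With it
  the identities below are polynomial in \<open>x\<close> and \<open>y\<close> and remain meaningful for \<open>q = 0\<close>.
\<close>

definition hpoch :: "'a \<Rightarrow> 'a \<Rightarrow> nat \<Rightarrow> 'a" where
  "hpoch x y k = (\<Prod>i<k. x - y * q ^ i)"

abbreviation qfact :: "nat \<Rightarrow> 'a" where
  "qfact k \<equiv> hpoch 1 q k"

text \<open>
  The reciprocal of \<open>(q;q)\<^sub>n\<^sub>-\<^sub>k\<close>, which is \<open>0\<close> if \<open>n < k\<close>.  This is the convention under which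
  terminating sums and their recurrences need no boundary cases.
\<close>

definition inv_qfact :: "nat \<Rightarrow> nat \<Rightarrow> 'a" where
  "inv_qfact n k = (if k \<le> n then 1 / qfact (n - k) else 0)"

lemma hpoch_0 [simp]: "hpoch x y 0 = 1"
  by (simp add: hpoch_def)

lemma hpoch_Suc: "hpoch x y (Suc k) = hpoch x y k * (x - y * q ^ k)"
  by (simp add: hpoch_def)

lemma hpoch_add: "hpoch x y (j + k) = hpoch x y j * hpoch x (y * q ^ j) k"
  by (induction k) (simp_all add: hpoch_Suc power_add mult_ac)

lemma hpoch_Suc': "hpoch x y (Suc k) = (x - y) * hpoch x (y * q) k"
  using hpoch_add[of x y 1 k] by (simp add: hpoch_def)

lemma qfact_nonzero [simp]: "qfact k \<noteq> 0"
  using power_q_neq_1 by (simp add: hpoch_def flip: power_Suc)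

lemma qfact_Suc: "qfact (Suc k) = qfact k * (1 - q ^ Suc k)"
  by (simp add: hpoch_Suc)

lemma one_minus_q_power: "1 - q ^ Suc k \<noteq> 0"
  using power_q_neq_1[of "Suc k"] by auto

lemma inv_qfact_Suc_right: "p \<le> a \<Longrightarrow> (1 - q ^ (a - p)) * inv_qfact a p = inv_qfact a (Suc p)"
proof (cases "p = a")
  case False
  assume "p \<le> a"
  with False obtain d where "a = p + Suc d"
    by (metis add_Suc_right less_imp_Suc_add nat_less_le)
  then show ?thesis
    using one_minus_q_power[of d] by (simp add: inv_qfact_def hpoch_Suc field_simps)
qed (simp add: inv_qfact_def)

lemma inv_qfact_simps [simp]: "inv_qfact n 0 = 1 / qfact n" "inv_qfact n n = 1" "n < k \<Longrightarrow> inv_qfact n k = 0"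
  by (simp_all add: inv_qfact_def)

lemma inv_qfact_add: "inv_qfact (j + n) (j + k) = inv_qfact n k"
  by (simp add: inv_qfact_def)

text \<open>
  The algebra common to the two creative telescoping arguments below: \<open>T\<close> is the summand for the
  larger index, \<open>t\<close> the one for the smaller index, \<open>Z\<close> the factor by which the closed forms differ,
  and \<open>G0\<close>, \<open>G1\<close> are the neighbouring values of the certificate.  Only the relation between
  the rational factors \<open>K\<close>, \<open>K2\<close>, \<open>K3\<close> is specific to the sum.
\<close>

lemma telescoping_step:
  assumes "T * n = c * (K :: 'a)" "K = Z * n - K2 * n + K3" "t = c" "G1 = - c * K2" "G0 * n = - c * K3"
  shows "T * n = (Z * t + (G1 - G0)) * n"
proof -
  have "(Z * t + (G1 - G0)) * n = Z * t * n + G1 * n - G0 * n"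
    by (simp add: algebra_simps)
  then show ?thesis
    unfolding assms by (simp add: algebra_simps)
qed

text \<open>
  The q-Pfaff-Saalschuetz sum.  It is read here as the expansion of a polynomial of degree \<open>p\<close> in
  \<open>y\<close> in the basis formed by the products \<open>(y - e) \<cdots> (y - e q\<^sup>k\<^sup>-\<^sup>1) (yh;q)\<^sub>p\<^sub>-\<^sub>k\<close>; the coefficients
  factor completely.
\<close>

lemma saalschuetz:
  "(\<Sum>k\<le>p. qfact p * inv_qfact p k / qfact k * hpoch (h * x) 1 k * hpoch y e k * hpoch x (e * q ^ k) (p - k) * hpoch 1 (y * h) (p - k))
   = hpoch x y p * hpoch 1 (e * h) p"
proof (induction p)
  case (Suc p)
  define t where "t p k = qfact p * inv_qfact p k / qfact k * hpoch (h * x) 1 k * hpoch y e k *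
      hpoch x (e * q ^ k) (p - k) * hpoch 1 (y * h) (p - k)" for p k
  \<comment> \<open>The certificate of the telescoping: consecutive differences of \<open>G\<close> account for the defect
    of the recurrence in \<open>p\<close>.\<close>
  define G where "G k = (if k = 0 then 0 else - (q ^ (Suc p - k)) * qfact p * inv_qfact (Suc p) k / qfact (k - 1) *
     hpoch (h * x) 1 k * hpoch y e k * hpoch x (e * q ^ (k - 1)) (Suc p - k) * hpoch 1 (y * h) (Suc p - k))" for k
  have step: "t (Suc p) k = (x - y * q ^ p) * (1 - e * h * q ^ p) * t p k + (G (Suc k) - G k)"
    if "k \<le> p" for k
  proof -
    from le_Suc_ex[OF that] obtain d where d: "p = k + d" by blast
    define nz where "nz = 1 - q * q ^ d"
    have nz: "nz \<noteq> 0" using one_minus_q_power[of d] by (simp add: nz_def)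
    define c where "c = qfact p / (qfact d * qfact k) * hpoch (h * x) 1 k * hpoch y e k * hpoch x (e * q ^ k) d * hpoch 1 (y * h) d"
    have t1: "t p k = c"
      by (simp add: t_def c_def d inv_qfact_def)
    have t2: "t (Suc p) k * nz = c * ((1 - q * q ^ d * q ^ k) * (x - e * q ^ k * q ^ d) * (1 - y * h * q ^ d))"
      using nz by (simp add: t_def c_def d inv_qfact_def Suc_diff_le hpoch_Suc nz_def power_add mult_ac)
    have g1: "G (Suc k) = - c * (q ^ d * (h * x - q ^ k) * (y - e * q ^ k))"
      by (simp add: G_def c_def d inv_qfact_def hpoch_Suc mult_ac)
    have g2: "G k * nz = - c * (q * q ^ d * (1 - q ^ k) * (x - e * q ^ (k - 1)) * (1 - y * h * q ^ d))"
    proof (cases k)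
      case (Suc j)
      have bx: "hpoch x (e * q ^ j) (Suc d) = (x - e * q ^ j) * hpoch x (e * q ^ k) d"
        unfolding Suc by (subst hpoch_Suc') (simp add: mult_ac)
      have nz': "1 - q * q ^ j \<noteq> 0" using one_minus_q_power[of j] by simp
      have "qfact k = qfact j * (1 - q * q ^ j)" by (simp add: Suc hpoch_Suc)
      then have "1 / qfact (k - 1) = (1 - q ^ k) / qfact k"
        using nz' by (simp add: Suc)
      moreover have "G k * nz = - (q ^ Suc d) * qfact p / qfact d * (1 / qfact (k - 1)) *
         hpoch (h * x) 1 k * hpoch y e k * hpoch x (e * q ^ j) (Suc d) * (hpoch 1 (y * h) d * (1 - y * h * q ^ d))"
        using nz by (simp add: G_def Suc inv_qfact_def hpoch_Suc[of 1] d nz_def mult_ac)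
      ultimately show ?thesis
        by (simp add: c_def bx mult_ac) (simp add: Suc mult_ac)
    qed (simp add: G_def)
    have core: "(1 - q * q ^ d * q ^ k) * (x - e * q ^ k * q ^ d) * (1 - y * h * q ^ d) =
      (x - y * q ^ p) * (1 - e * h * q ^ p) * nz - (q ^ d * (h * x - q ^ k) * (y - e * q ^ k)) * nz
       + q * q ^ d * (1 - q ^ k) * (x - e * q ^ (k - 1)) * (1 - y * h * q ^ d)"
      by (cases k) (simp_all add: nz_def d power_add algebra_simps)
    have "t (Suc p) k * nz = ((x - y * q ^ p) * (1 - e * h * q ^ p) * t p k + (G (Suc k) - G k)) * nz"
      by (rule telescoping_step[OF t2 core t1 g1 g2])
    with nz show ?thesis by simp
  qed
  have G0: "(\<Sum>k\<le>p. G (Suc k) - G k) = G (Suc p)"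
    using sum_lessThan_telescope[of G "Suc p"] by (simp add: lessThan_Suc_atMost G_def)
  have last: "G (Suc p) + t (Suc p) (Suc p) = 0"
    using one_minus_q_power[of p] by (simp add: G_def t_def qfact_Suc)
  have IH: "(\<Sum>k\<le>p. t p k) = hpoch x y p * hpoch 1 (e * h) p"
    unfolding t_def by (rule Suc.IH)
  have "(\<Sum>k\<le>Suc p. t (Suc p) k) = (x - y * q ^ p) * (1 - e * h * q ^ p) * (\<Sum>k\<le>p. t p k)
      + (G (Suc p) + t (Suc p) (Suc p))"
    unfolding sum_distrib_left G0[symmetric] by (simp add: step sum.distrib)
  then have "(\<Sum>k\<le>Suc p. t (Suc p) k) = hpoch x y (Suc p) * hpoch 1 (e * h) (Suc p)"
    unfolding last IH hpoch_Suc by (simp add: mult_ac)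
  then show ?case
    unfolding t_def .
qed simp

text \<open>
  The q-Pfaff-Saalschuetz sum again, for parameters that are nonnegative powers of \<open>q\<close>.  It could be
  obtained from the preceding form only by dividing by a power of \<open>q\<close>; the separate proof covers \<open>q = 0\<close>.
  If \<open>a + b > m\<close>, the sum vanishes.
\<close>

lemma saalschuetz_power:
  assumes "a \<le> m" "b \<le> m"
  shows "(\<Sum>p\<le>b. hpoch 1 u (b - p) * hpoch (u * q ^ (m - a)) 1 p * qfact (m - p) * inv_qfact b p * inv_qfact a p / qfact p)
    = hpoch (q ^ a) u b * qfact (m - a) * qfact (m - b) * inv_qfact m (a + b) / (qfact a * qfact b)"
  using assms(2)
proof (induction b)
  case 0
  then show ?case using assms(1) by (simp add: inv_qfact_def)
next
  case (Suc b)
  define v where "v = q ^ (m - a)"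
  \<comment> \<open>\<open>Z\<close> equals \<open>(q\<^sup>a - u q\<^sup>b) (1 - q\<^sup>m\<^sup>-\<^sup>a\<^sup>-\<^sup>b)\<close>, expanded so that no negative power arises for \<open>a + b > m\<close>.\<close>
  define Z where "Z = q ^ a - u * q ^ b - q ^ (m - b) + u * v"
  define t where "t b p = hpoch 1 u (b - p) * hpoch (u * v) 1 p * qfact (m - p) * inv_qfact b p * inv_qfact a p / qfact p" for b p
  \<comment> \<open>The same certificate as before, rescaled by powers of \<open>q\<close>.\<close>
  define G where "G p = (if p = 0 then 0 else - hpoch (u * v) 1 p * hpoch 1 u (Suc b - p) * inv_qfact (Suc b) p / qfact (p - 1)
     * qfact (Suc m - p) * inv_qfact a p)" for p
  have step: "(1 - q ^ Suc b) * (1 - q ^ (m - b)) * t (Suc b) p = Z * t b p + (G (Suc p) - G p)"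
    if "p \<le> b" for p
  proof (cases "p \<le> a")
    case False
    then show ?thesis by (simp add: t_def G_def)
  next
    case True
    from le_Suc_ex[OF that] obtain d where d: "b = p + d" by blast
    from le_Suc_ex[OF True] obtain j where j: "a = p + j" by blast
    have "Suc b \<le> m" by (rule Suc.prems)
    then obtain l where l: "m = b + Suc l" using le_Suc_ex[of "Suc b" m] by auto
    define n where "n = 1 - q * q ^ d"
    have n: "n \<noteq> 0" using one_minus_q_power[of d] by (simp add: n_def)
    define c where "c = hpoch 1 u d * hpoch (u * v) 1 p * qfact (m - p) / (qfact d * qfact j * qfact p)"
    have v: "v * q ^ a = q ^ m" using assms(1) by (simp add: v_def flip: power_add)
    have t1: "t b p = c" by (simp add: t_def c_def d j inv_qfact_def)
    have t2: "((1 - q ^ Suc b) * (1 - q ^ (m - b)) * t (Suc b) p) * n =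
        c * ((1 - q ^ Suc b) * (1 - q ^ (m - b)) * (1 - u * q ^ d))"
      using n by (simp add: t_def c_def d j inv_qfact_def Suc_diff_le hpoch_Suc n_def mult_ac)
    have g1: "G (Suc p) = - c * ((u * v - q ^ p) * (1 - q ^ j))"
    proof -
      have "inv_qfact a (Suc p) = (1 - q ^ j) / qfact j"
        using inv_qfact_Suc_right[of p a] by (simp add: j inv_qfact_def)
      then show ?thesis
        by (simp add: G_def c_def d hpoch_Suc inv_qfact_def mult_ac)
    qed
    have g2: "G p * n = - c * ((1 - u * q ^ d) * (1 - q ^ p) * (1 - q ^ (Suc m - p)))"
    proof (cases p)
      case (Suc i)
      have nz': "1 - q * q ^ i \<noteq> 0" using one_minus_q_power[of i] by simp
      have "qfact p = qfact i * (1 - q * q ^ i)" by (simp add: Suc hpoch_Suc)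
      then have "1 / qfact (p - 1) = (1 - q ^ p) / qfact p"
        using nz' by (simp add: Suc)
      moreover have "qfact (Suc m - p) = qfact (m - p) * (1 - q ^ (Suc m - p))"
        using that Suc.prems by (simp add: Suc_diff_le hpoch_Suc)
      moreover have "G p * n = - hpoch (u * v) 1 p * (hpoch 1 u d * (1 - u * q ^ d)) / qfact d * (1 / qfact (p - 1)) *
          qfact (Suc m - p) / qfact j"
        using n by (simp add: G_def Suc inv_qfact_def hpoch_Suc[of 1 _ d] d j n_def Suc_diff_le mult_ac)
      ultimately show ?thesis
        by (simp add: c_def mult_ac)
    qed (simp add: G_def)
    have core: "(1 - q ^ Suc b) * (1 - q ^ (m - b)) * (1 - u * q ^ d) =
      Z * n - (u * v - q ^ p) * (1 - q ^ j) * n + (1 - u * q ^ d) * (1 - q ^ p) * (1 - q ^ (Suc m - p))"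
    proof -
      define A B P L where "A = q ^ j" and "B = q ^ d" and "P = q ^ p" and "L = q ^ l"
      have "m - a + j = Suc (d + l)"
        using assms(1) by (simp add: j l d)
      then have v: "v * A = q * (B * L)"
        unfolding v_def A_def B_def L_def by (simp flip: power_add power_Suc)
      have eqs: "q ^ Suc b = q * P * B" "q ^ (m - b) = q * L" "q ^ (Suc m - p) = q * q * B * L"
        "q ^ a = P * A" "q ^ b = P * B"
        by (simp_all add: A_def B_def P_def L_def j d l power_add mult_ac)
      have "(1 - q * P * B) * (1 - q * L) * (1 - u * B) =
          (P * A - u * (P * B) - q * L + u * v) * (1 - q * B) - (u * v - P) * (1 - A) * (1 - q * B)
            + (1 - u * B) * (1 - P) * (1 - q * q * B * L)"
        using v by algebra
      then show ?thesis
        unfolding Z_def n_def eqs unfolding A_def B_def P_def .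
    qed
    have "((1 - q ^ Suc b) * (1 - q ^ (m - b)) * t (Suc b) p) * n = (Z * t b p + (G (Suc p) - G p)) * n"
      by (rule telescoping_step[OF t2 core t1 g1 g2])
    with n show ?thesis by simp
  qed
  have G0: "(\<Sum>p\<le>b. G (Suc p) - G p) = G (Suc b)"
    using sum_lessThan_telescope[of G "Suc b"] by (simp add: lessThan_Suc_atMost G_def)
  have last: "G (Suc b) + (1 - q ^ Suc b) * (1 - q ^ (m - b)) * t (Suc b) (Suc b) = 0"
  proof -
    have "qfact (m - b) = qfact (m - Suc b) * (1 - q ^ (m - b))"
      using Suc.prems qfact_Suc[of "m - Suc b"] by (simp add: Suc_diff_Suc)
    then show ?thesis
      using one_minus_q_power[of b] by (simp add: G_def t_def qfact_Suc)
  qed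
  have IH: "(\<Sum>p\<le>b. t b p) = hpoch (q ^ a) u b * qfact (m - a) * qfact (m - b) * inv_qfact m (a + b) / (qfact a * qfact b)"
    using Suc unfolding t_def v_def by simp
  have "(1 - q ^ Suc b) * (1 - q ^ (m - b)) * (\<Sum>p\<le>Suc b. t (Suc b) p) = Z * (\<Sum>p\<le>b. t b p)
      + (G (Suc b) + (1 - q ^ Suc b) * (1 - q ^ (m - b)) * t (Suc b) (Suc b))"
  proof -
    have "(1 - q ^ Suc b) * (1 - q ^ (m - b)) * (\<Sum>p\<le>b. t (Suc b) p) = (\<Sum>p\<le>b. Z * t b p + (G (Suc p) - G p))"
      unfolding sum_distrib_left by (rule sum.cong[OF refl], rule step) simp
    also have "\<dots> = Z * (\<Sum>p\<le>b. t b p) + G (Suc b)"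
      unfolding sum.distrib G0 sum_distrib_left ..
    finally show ?thesis
      unfolding sum.atMost_Suc distrib_left[of "(1 - q ^ Suc b) * (1 - q ^ (m - b))"] by simp
  qed
  then have "(1 - q ^ Suc b) * (1 - q ^ (m - b)) * (\<Sum>p\<le>Suc b. t (Suc b) p) =
      Z * (hpoch (q ^ a) u b * qfact (m - a) * qfact (m - b) * inv_qfact m (a + b) / (qfact a * qfact b))"
    unfolding last IH by simp
  also have "\<dots> = (1 - q ^ Suc b) * (1 - q ^ (m - b)) *
      (hpoch (q ^ a) u (Suc b) * qfact (m - a) * qfact (m - Suc b) * inv_qfact m (a + Suc b) / (qfact a * qfact (Suc b)))"
  proof -
    have nz: "1 - q ^ Suc b \<noteq> 0" "1 - q ^ (m - b) \<noteq> 0"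
      using one_minus_q_power[of b] one_minus_q_power[of "m - Suc b"] Suc.prems by (simp_all add: Suc_diff_Suc)
    have qfact_m: "qfact (m - b) = qfact (m - Suc b) * (1 - q ^ (m - b))"
      using Suc.prems qfact_Suc[of "m - Suc b"] by (simp add: Suc_diff_Suc)
    have "Z * inv_qfact m (a + b) = (q ^ a - u * q ^ b) * inv_qfact m (a + Suc b)"
    proof (cases "a + b \<le> m")
      case True
      have "q ^ a * q ^ (m - (a + b)) = q ^ (m - b)" "q ^ b * q ^ (m - (a + b)) = v"
        using True by (simp_all add: v_def flip: power_add)
      then have "Z = (q ^ a - u * q ^ b) * (1 - q ^ (m - (a + b)))"
        by (simp add: Z_def left_diff_distrib right_diff_distrib mult.assoc)
      then show ?thesis
        using inv_qfact_Suc_right[OF True] by simp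
    qed simp
    then have "Z * (hpoch (q ^ a) u b * qfact (m - a) * qfact (m - b) * inv_qfact m (a + b) / (qfact a * qfact b)) =
       (q ^ a - u * q ^ b) * inv_qfact m (a + Suc b) * (hpoch (q ^ a) u b * qfact (m - a) * qfact (m - b) / (qfact a * qfact b))"
      by (simp add: mult_ac)
    also have "\<dots> = (1 - q ^ Suc b) * (1 - q ^ (m - b)) *
      (hpoch (q ^ a) u (Suc b) * qfact (m - a) * qfact (m - Suc b) * inv_qfact m (a + Suc b) / (qfact a * qfact (Suc b)))"
      unfolding qfact_m qfact_Suc[of b] hpoch_Suc[of "q ^ a"] using nz(1) by simp
    finally show ?thesis .
  qed
  finally have "(1 - q ^ Suc b) * (1 - q ^ (m - b)) * (\<Sum>p\<le>Suc b. t (Suc b) p) =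
     (1 - q ^ Suc b) * (1 - q ^ (m - b)) *
      (hpoch (q ^ a) u (Suc b) * qfact (m - a) * qfact (m - Suc b) * inv_qfact m (a + Suc b) / (qfact a * qfact (Suc b)))" .
  moreover have "(1 - q ^ Suc b) * (1 - q ^ (m - b)) \<noteq> 0"
    using one_minus_q_power[of b] one_minus_q_power[of "m - Suc b"] Suc.prems by (simp add: Suc_diff_Suc)
  ultimately show ?case
    unfolding t_def v_def by (rule mult_left_cancel[THEN iffD1, rotated])
qed

text \<open>
  A terminating balanced \<open>\<^sub>4\<phi>\<^sub>3\<close> series.  Up to simple factors it is an entry of
  the product of the matrix of one column with the matrix \<open>E\<close>.
\<close>

definition exchange_sum :: "'a \<Rightarrow> 'a \<Rightarrow> 'a \<Rightarrow> 'a \<Rightarrow> nat \<Rightarrow> nat \<Rightarrow> nat \<Rightarrow> 'a" where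
  "exchange_sum x y C D a b m =
    (\<Sum>p\<le>b. hpoch 1 (x * D) (b - p) * hpoch y C (a - p) * hpoch x y p * qfact (m - p) * inv_qfact b p * inv_qfact a p
       / (qfact p * hpoch 1 (C * D) (m - p)))"

text \<open>
  The image of the previous series under Sears' transformation.  In contrast to it, this sum is
  symmetric, apart from a product in front, under \<open>(a, b) \<mapsto> (m - b, m - a)\<close>.
\<close>

definition sears_sum :: "'a \<Rightarrow> 'a \<Rightarrow> 'a \<Rightarrow> 'a \<Rightarrow> nat \<Rightarrow> nat \<Rightarrow> nat \<Rightarrow> 'a" where
  "sears_sum x y C D a b m =
    (\<Sum>s\<le>b. hpoch (q ^ (a - s)) (x * D) (b - s) * hpoch y C (a - s) * hpoch x (C * q ^ (a - s)) s *
       hpoch 1 (y * D) (m - a + s) * inv_qfact a s * inv_qfact b s * inv_qfact (m + s) (a + b) / qfact s)"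

text \<open>
  Sears' transformation.  The factor \<open>hpoch x y p * hpoch 1 (e * h) p\<close> of each summand is expanded
  by the Saalschuetz sum in such a way that the \<open>y\<close>-dependence of the result no longer involves
  \<open>p\<close>.  The sum over \<open>p\<close> can then be carried out, again by the Saalschuetz sum.
\<close>

lemma exchange_sum_eq:
  assumes "a \<le> m" "b \<le> m" and nz: "\<And>k. hpoch 1 (C * D) k \<noteq> 0"
  shows "exchange_sum x y C D a b m * hpoch 1 (y * D) (m - a) * hpoch 1 (C * D) m = qfact (m - a) * qfact (m - b) * sears_sum x y C D a b m"
proof -
  define u where "u = x * D"
  define h where "h = D * q ^ (m - a)"
  have hx: "h * x = u * q ^ (m - a)" by (simp add: h_def u_def)
  define F where "F s r = hpoch y C (a - s) * hpoch x (C * q ^ (a - s)) s * hpoch 1 (y * D) (m - a + s) / qfact s *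
      (hpoch 1 u (b - s - r) * hpoch (h * x) 1 r * qfact (m - s - r) * inv_qfact b (s + r) * inv_qfact a (s + r) / qfact r)" for s r
  have expand: "hpoch 1 u (b - p) * hpoch y C (a - p) * hpoch x y p * qfact (m - p) * inv_qfact b p * inv_qfact a p
       / (qfact p * hpoch 1 (C * D) (m - p)) * hpoch 1 (y * D) (m - a) * hpoch 1 (C * D) m = (\<Sum>r\<le>p. F (p - r) r)"
    if "p \<le> b" for p
  proof (cases "p \<le> a")
    case True
    define e where "e = C * q ^ (a - p)"
    have "e * h = C * D * q ^ (m - p)"
      using True assms(1) by (simp add: e_def h_def flip: power_add)
    then have "hpoch 1 (C * D) m = hpoch 1 (C * D) (m - p) * hpoch 1 (e * h) p"
      using hpoch_add[of 1 "C * D" "m - p" p] that assms(2) by simp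
    then have "hpoch 1 u (b - p) * hpoch y C (a - p) * hpoch x y p * qfact (m - p) * inv_qfact b p * inv_qfact a p
       / (qfact p * hpoch 1 (C * D) (m - p)) * hpoch 1 (y * D) (m - a) * hpoch 1 (C * D) m =
       hpoch 1 u (b - p) * hpoch y C (a - p) * qfact (m - p) * inv_qfact b p * inv_qfact a p * hpoch 1 (y * D) (m - a)
       / qfact p * (hpoch x y p * hpoch 1 (e * h) p)"
      using nz[of "m - p"] by simp
    also have "\<dots> = (\<Sum>r\<le>p. F (p - r) r)"
      unfolding saalschuetz[symmetric] sum_distrib_left
    proof (rule sum.cong[OF refl])
      fix r assume "r \<in> {..p}"
      then obtain s where s: "p = s + r" using le_Suc_ex[of r p] by (auto simp: add.commute)
      have y: "hpoch y C (a - s) = hpoch y C (a - p) * hpoch y e r"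
        using hpoch_add[of y C "a - p" r] True by (simp add: s e_def)
      have x: "C * q ^ (a - s) = e * q ^ r"
        using True by (simp add: s e_def mult.assoc flip: power_add)
      have yD: "hpoch 1 (y * D) (m - a + s) = hpoch 1 (y * D) (m - a) * hpoch 1 (y * h) s"
        by (simp add: hpoch_add h_def mult_ac)
      have [simp]: "inv_qfact (s + r) r = 1 / qfact s" by (simp add: inv_qfact_def)
      show "hpoch 1 u (b - p) * hpoch y C (a - p) * qfact (m - p) * inv_qfact b p * inv_qfact a p * hpoch 1 (y * D) (m - a) / qfact p *
         (qfact p * inv_qfact p r / qfact r * hpoch (h * x) 1 r * hpoch y e r * hpoch x (e * q ^ r) (p - r) * hpoch 1 (y * h) (p - r))
         = F (p - r) r"
        unfolding F_def s add_diff_cancel_right' y[unfolded s] x yD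
        by (simp add: mult_ac)
    qed
    finally show ?thesis .
  qed (simp add: F_def)
  have "exchange_sum x y C D a b m * hpoch 1 (y * D) (m - a) * hpoch 1 (C * D) m = (\<Sum>p\<le>b. \<Sum>r\<le>p. F (p - r) r)"
    unfolding exchange_sum_def sum_distrib_right u_def[symmetric] by (intro sum.cong refl expand) simp
  also have "\<dots> = (\<Sum>s\<le>b. \<Sum>r\<le>b - s. F s r)"
    unfolding sum.Sigma[OF finite_atMost ballI[OF finite_atMost]]
    by (rule sum.reindex_bij_witness[of _ "\<lambda>(s, r). (s + r, r)" "\<lambda>(p, r). (p - r, r)"]) auto
  also have "\<dots> = (\<Sum>s\<le>b. qfact (m - a) * qfact (m - b) *
     (hpoch (q ^ (a - s)) (x * D) (b - s) * hpoch y C (a - s) * hpoch x (C * q ^ (a - s)) s *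
       hpoch 1 (y * D) (m - a + s) * inv_qfact a s * inv_qfact b s * inv_qfact (m + s) (a + b) / qfact s))"
  proof (rule sum.cong[OF refl])
    fix s assume "s \<in> {..b}"
    then have s: "s \<le> b" "s \<le> m" using assms by auto
    show "(\<Sum>r\<le>b - s. F s r) = qfact (m - a) * qfact (m - b) *
     (hpoch (q ^ (a - s)) (x * D) (b - s) * hpoch y C (a - s) * hpoch x (C * q ^ (a - s)) s *
       hpoch 1 (y * D) (m - a + s) * inv_qfact a s * inv_qfact b s * inv_qfact (m + s) (a + b) / qfact s)"
    proof (cases "s \<le> a")
      case True
      have ab: "inv_qfact b (s + r) = inv_qfact (b - s) r" "inv_qfact a (s + r) = inv_qfact (a - s) r" for r
        using inv_qfact_add[of s "b - s" r] inv_qfact_add[of s "a - s" r] True s by simp_all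
      have m: "inv_qfact (m - s) (a - s + (b - s)) = inv_qfact (m + s) (a + b)"
        using inv_qfact_add[of "2 * s" "m - s" "a - s + (b - s)"] True s by (simp add: algebra_simps)
      have [simp]: "m - s - (a - s) = m - a" "m - s - (b - s) = m - b"
        using True s by auto
      have "(\<Sum>r\<le>b - s. hpoch 1 u (b - s - r) * hpoch (h * x) 1 r * qfact (m - s - r) * inv_qfact (b - s) r * inv_qfact (a - s) r / qfact r)
        = hpoch (q ^ (a - s)) u (b - s) * qfact (m - a) * qfact (m - b) * inv_qfact (m + s) (a + b) / (qfact (a - s) * qfact (b - s))"
        using saalschuetz_power[of "a - s" "m - s" "b - s" u] assms True s m by (simp add: hx diff_le_mono)
      then show ?thesis
        unfolding F_def sum_distrib_left[symmetric] ab using True s by (simp add: inv_qfact_def u_def mult_ac)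
    qed (simp add: F_def)
  qed
  finally show ?thesis
    by (simp add: sears_sum_def sum_distrib_left)
qed

text \<open>
  The substitution \<open>s \<mapsto> m + s - (a + b)\<close> preserves \<open>a - s\<close>, \<open>b - s\<close> and \<open>m - a + s\<close> when \<open>(a, b)\<close> is
  replaced by \<open>(m - b, m - a)\<close>.  The only asymmetric factor is a product over the indices from
  \<open>a - s\<close> to \<open>a - 1\<close>, and the factors in front of the sums complete it.
\<close>

lemma sears_sum_symmetric:
  assumes "a \<le> m" "b \<le> m"
  shows "hpoch x C (m - b) * sears_sum x y C D a b m = hpoch x C a * sears_sum x y C D (m - b) (m - a) m"
proof -
  define S where "S a b = {s. s \<le> a \<and> s \<le> b \<and> a + b \<le> m + s}" for a b
  define t where "t a b s = hpoch (q ^ (a - s)) (x * D) (b - s) * hpoch y C (a - s) * hpoch x (C * q ^ (a - s)) s *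
       hpoch 1 (y * D) (m - a + s) / (qfact (a - s) * qfact (b - s) * qfact (m + s - (a + b)) * qfact s)" for a b s
  have sears_sum: "sears_sum x y C D a b m = sum (t a b) (S a b)" if "a \<le> m" "b \<le> m" for a b
    unfolding sears_sum_def
    by (rule sum.mono_neutral_cong_right) (auto simp: S_def t_def inv_qfact_def)
  have "hpoch x C (m - b) * t a b s = hpoch x C a * t (m - b) (m - a) (m + s - (a + b))" if "s \<in> S a b" for s
  proof -
    define s' where "s' = m + s - (a + b)"
    have eqs: "m - b - s' = a - s" "m - a - s' = b - s" "m - (m - b) + s' = m - a + s"
       "m + s' - (m - b + (m - a)) = s" and mb: "m - b = a - s + s'"
      using that assms by (auto simp: S_def s'_def)
    have a: "a = (a - s) + s" using that by (auto simp: S_def)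
    have 1: "hpoch x C (m - b) = hpoch x C (a - s) * hpoch x (C * q ^ (a - s)) s'"
      using hpoch_add[of x C "a - s" s'] by (simp add: mb)
    have 2: "hpoch x C a = hpoch x C (a - s) * hpoch x (C * q ^ (a - s)) s"
      using hpoch_add[of x C "a - s" s] a by simp
    show ?thesis
      unfolding 1 2 s'_def[symmetric] t_def eqs unfolding s'_def[symmetric] by (simp add: mult_ac)
  qed
  then have "hpoch x C (m - b) * sum (t a b) (S a b) = hpoch x C a * sum (t (m - b) (m - a)) (S (m - b) (m - a))"
    unfolding sum_distrib_left using assms
    by (intro sum.reindex_bij_witness[of _ "\<lambda>s. s + a + b - m" "\<lambda>s. m + s - (a + b)"])
       (auto simp: S_def)
  then show ?thesis using assms by (simp add: sears_sum)
qed

lemma exchange_sum_symmetric: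
  assumes "a \<le> m" "b \<le> m" and nz: "\<And>k. hpoch 1 (C * D) k \<noteq> 0"
  shows "hpoch 1 (y * D) (m - a) / qfact (m - a) * hpoch x C (m - b) / qfact (m - b) * exchange_sum x y C D a b m
       = hpoch 1 (y * D) b / qfact b * hpoch x C a / qfact a * exchange_sum x y C D (m - b) (m - a) m"
proof -
  have 1: "exchange_sum x y C D a b m * hpoch 1 (y * D) (m - a) = qfact (m - a) * qfact (m - b) * sears_sum x y C D a b m / hpoch 1 (C * D) m"
    using exchange_sum_eq[OF assms, of x y] nz[of m] by (simp add: field_simps)
  have 2: "exchange_sum x y C D (m - b) (m - a) m * hpoch 1 (y * D) b = qfact b * qfact a * sears_sum x y C D (m - b) (m - a) m / hpoch 1 (C * D) m"
    using exchange_sum_eq[of "m - b" m "m - a" C D x y] nz assms by (simp add: field_simps)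
  have "hpoch 1 (y * D) (m - a) / qfact (m - a) * hpoch x C (m - b) / qfact (m - b) * exchange_sum x y C D a b m
     = (exchange_sum x y C D a b m * hpoch 1 (y * D) (m - a)) * hpoch x C (m - b) / (qfact (m - a) * qfact (m - b))"
    by simp
  also have "\<dots> = hpoch x C (m - b) * sears_sum x y C D a b m / hpoch 1 (C * D) m"
    unfolding 1 by simp
  also have "\<dots> = (exchange_sum x y C D (m - b) (m - a) m * hpoch 1 (y * D) b) * hpoch x C a / (qfact b * qfact a)"
    unfolding 2 sears_sum_symmetric[OF assms(1,2)] by simp
  finally show ?thesis by simp
qed

text \<open>
  The q-binomial theorem, as the case \<open>D = 0\<close>, \<open>a = b = m\<close> of the symmetry just proved.
\<close>

lemma q_binomial:
  "(\<Sum>s\<le>N. hpoch x y s / qfact s * (hpoch y c (N - s) / qfact (N - s))) = hpoch x c N / qfact N"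
proof -
  have "(\<Sum>s\<le>N. hpoch x y s / qfact s * (hpoch y c (N - s) / qfact (N - s))) = exchange_sum x y c 0 N N N"
    unfolding exchange_sum_def by (rule sum.cong) (auto simp: inv_qfact_def hpoch_def mult.commute)
  also have "\<dots> = hpoch x c N / qfact N"
    using exchange_sum_symmetric[of N N N c 0 y x] by (simp add: exchange_sum_def hpoch_def inv_qfact_def)
  finally show ?thesis .
qed

section \<open>Exchange relation for two neighbouring rows\<close>

text \<open>
  The weight of one column of two superposed rows \<open>\<nu> \<preceq> \<mu> \<preceq> \<lambda>\<close>, the upper row carrying \<open>y\<close> and the
  lower one \<open>x\<close>.  Here \<open>m\<close> and \<open>m'\<close> are \<open>\<mu>\<^sub>r\<close> and \<open>\<mu>\<^sub>r\<^sub>+\<^sub>1\<close>, \<open>l\<close> is \<open>\<lambda>\<^sub>r\<^sub>+\<^sub>1\<close> and \<open>v\<close> is \<open>\<nu>\<^sub>r\<close>.  The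
  parameter \<open>C = c\<^sub>r\<^sub>+\<^sub>1\<close> occurs twice: the lower row is built with the sequence \<open>c\<close> shifted by one,
  and the factor of the upper row belonging to \<open>\<lambda>\<^sub>r\<^sub>+\<^sub>1 - \<mu>\<^sub>r\<^sub>+\<^sub>1\<close> is counted in this column.  Factors that
  depend on \<open>\<lambda>\<close> alone are left out, since they do not affect the symmetry in \<open>x\<close> and \<open>y\<close>.
\<close>

definition column_weight :: "'a \<Rightarrow> 'a \<Rightarrow> nat \<Rightarrow> nat \<Rightarrow> 'a \<Rightarrow> 'a \<Rightarrow> nat \<Rightarrow> nat \<Rightarrow> 'a" where
  "column_weight C D l v x y m m' =
    (if l \<le> m \<and> v \<le> m \<and> m' \<le> v \<and> m' \<le> l then
       hpoch 1 (y * D) (m - l) / qfact (m - l) * (hpoch x C (m - v) / qfact (m - v)) *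
       (hpoch 1 (x * D) (v - m') / qfact (v - m')) * (qfact (m - m') / hpoch 1 (C * D) (m - m')) *
       (hpoch y C (l - m') / qfact (l - m'))
     else 0)"

text \<open>
  The relation \<open>W(x,y) E = E W(y,x)\<close> for one column, entry by entry.
\<close>

lemma column_weight_exchange:
  assumes nz: "\<And>k. hpoch 1 (C * D) k \<noteq> 0" and "k \<le> m"
  shows "(\<Sum>p\<le>m - k. column_weight C D l v x y m (k + p) * (hpoch x y p / qfact p)) =
         (\<Sum>s\<le>m - k. hpoch x y s / qfact s * column_weight C D l v y x (m - s) k)"
proof (cases "l \<le> m \<and> v \<le> m \<and> k \<le> v \<and> k \<le> l")
  case False
  then have "column_weight C D l v x y m (k + p) = 0" "column_weight C D l v y x (m - p) k = 0" for p
    by (auto simp: column_weight_def)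
  then show ?thesis by simp
next
  case True
  have "(\<Sum>p\<le>m - k. column_weight C D l v x y m (k + p) * (hpoch x y p / qfact p)) =
     hpoch 1 (y * D) (m - l) / qfact (m - l) * hpoch x C (m - v) / qfact (m - v) * exchange_sum x y C D (l - k) (v - k) (m - k)"
    unfolding exchange_sum_def sum_distrib_left
    by (rule sum.mono_neutral_cong_right) (use True in \<open>auto simp: column_weight_def inv_qfact_def mult_ac\<close>)
  also have "\<dots> = hpoch 1 (y * D) (v - k) / qfact (v - k) * hpoch x C (l - k) / qfact (l - k) * exchange_sum x y C D (m - v) (m - l) (m - k)"
    using exchange_sum_symmetric[of "l - k" "m - k" "v - k" C D y x] nz True by (simp add: diff_le_mono)
  also have "\<dots> = (\<Sum>s\<le>m - k. hpoch x y s / qfact s * column_weight C D l v y x (m - s) k)"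
    unfolding exchange_sum_def sum_distrib_left
    by (rule sum.mono_neutral_cong_left) (use True in \<open>auto simp: column_weight_def inv_qfact_def mult_ac add.commute\<close>)
  finally show ?thesis .
qed

text \<open>
  If two vectors are related by \<open>E\<close>, so are their images under the column matrices.  The
  hypothesis is needed only up to \<open>v\<close>, because the column weight vanishes beyond it; this is what
  makes the vector at the right end of the chain admissible.
\<close>

lemma exchange_step:
  fixes g g' :: "nat \<Rightarrow> 'a"
  assumes nz: "\<And>k. hpoch 1 (C * D) k \<noteq> 0"
    and g: "\<And>m'. m' \<le> v \<Longrightarrow> g m' = (\<Sum>k\<le>m'. hpoch x y (m' - k) / qfact (m' - k) * g' k)"
  shows "(\<Sum>m'\<le>m. column_weight C D l v x y m m' * g m') =
    (\<Sum>j\<le>m. hpoch x y (m - j) / qfact (m - j) * (\<Sum>k\<le>j. column_weight C D l v y x j k * g' k))"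
proof -
  have "(\<Sum>m'\<le>m. column_weight C D l v x y m m' * g m') =
     (\<Sum>m'\<le>m. \<Sum>k\<le>m'. column_weight C D l v x y m m' * (hpoch x y (m' - k) / qfact (m' - k) * g' k))"
    unfolding sum_distrib_left[symmetric] by (rule sum.cong) (auto simp: g column_weight_def)
  also have "\<dots> = (\<Sum>k\<le>m. \<Sum>p\<le>m - k. column_weight C D l v x y m (k + p) * (hpoch x y p / qfact p) * g' k)"
    unfolding sum.Sigma[OF finite_atMost ballI[OF finite_atMost]]
    by (rule sum.reindex_bij_witness[of _ "\<lambda>(k, p). (k + p, k)" "\<lambda>(m', k). (k, m' - k)"]) auto
  also have "\<dots> = (\<Sum>k\<le>m. \<Sum>s\<le>m - k. hpoch x y s / qfact s * column_weight C D l v y x (m - s) k * g' k)"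
    unfolding sum_distrib_right[symmetric] by (rule sum.cong) (auto simp del: times_divide_eq_right simp: column_weight_exchange[OF nz])
  also have "\<dots> = (\<Sum>j\<le>m. \<Sum>k\<le>j. hpoch x y (m - j) / qfact (m - j) * column_weight C D l v y x j k * g' k)"
    unfolding sum.Sigma[OF finite_atMost ballI[OF finite_atMost]]
    by (rule sum.reindex_bij_witness[of _ "\<lambda>(j, k). (k, m - j)" "\<lambda>(k, s). (m - s, k)"]) auto
  finally show ?thesis by (simp add: sum_distrib_left mult.assoc)
qed

text \<open>
  The weight of all columns to the right of a given value \<open>m\<close> of \<open>\<mu>\<^sub>0\<close>, the parts of \<open>\<mu>\<close> after
  it being summed over.
\<close>

fun transfer :: "nat \<Rightarrow> (nat \<Rightarrow> 'a) \<Rightarrow> (nat \<Rightarrow> 'a) \<Rightarrow> (nat \<Rightarrow> nat) \<Rightarrow> (nat \<Rightarrow> nat) \<Rightarrow> 'a \<Rightarrow> 'a \<Rightarrow> nat \<Rightarrow> 'a" where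
  "transfer 0 c d lam \<nu> x y m = (if m = 0 then 1 else 0)"
| "transfer (Suc n) c d lam \<nu> x y m = (\<Sum>m'\<le>m. column_weight (c 1) (d 0) (lam 1) (\<nu> 0) x y m m' *
     transfer n (\<lambda>i. c (Suc i)) (\<lambda>i. d (Suc i)) (\<lambda>i. lam (Suc i)) (\<lambda>i. \<nu> (Suc i)) x y m')"

text \<open>
  Pulling \<open>E\<close> through all columns.  The induction starts with a single column, where \<open>\<nu> n = 0\<close>
  leaves only \<open>\<mu>\<^sub>n\<^sub>+\<^sub>1 = 0\<close> and \<open>E\<close> has the diagonal entry \<open>1\<close>.
\<close>

lemma transfer_exchange:
  assumes "\<And>i k. i < Suc n \<Longrightarrow> hpoch 1 (c (Suc i) * d i) k \<noteq> 0" "\<nu> n = 0"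
  shows "transfer (Suc n) c d lam \<nu> x y m =
    (\<Sum>j\<le>m. hpoch x y (m - j) / qfact (m - j) * transfer (Suc n) c d lam \<nu> y x j)"
  using assms
proof (induction n arbitrary: c d lam \<nu> m)
  case 0
  show ?case
    unfolding transfer.simps(2)
    by (rule exchange_step) (use 0 in auto)
next
  case (Suc n)
  show ?case
    unfolding transfer.simps(2)[of "Suc n"]
  proof (rule exchange_step)
    show "hpoch 1 (c 1 * d 0) k \<noteq> 0" for k
      using Suc.prems(1)[of 0 k] by simp
    show "transfer (Suc n) (\<lambda>i. c (Suc i)) (\<lambda>i. d (Suc i)) (\<lambda>i. lam (Suc i)) (\<lambda>i. \<nu> (Suc i)) x y m' =
      (\<Sum>k\<le>m'. hpoch x y (m' - k) / qfact (m' - k) *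
         transfer (Suc n) (\<lambda>i. c (Suc i)) (\<lambda>i. d (Suc i)) (\<lambda>i. lam (Suc i)) (\<lambda>i. \<nu> (Suc i)) y x k)" for m'
      by (rule Suc.IH) (use Suc.prems in auto)
  qed
qed

text \<open>
  At the left end the remaining factor of the upper row belongs to \<open>\<lambda>\<^sub>0 - \<mu>\<^sub>0\<close>; by the q-binomial
  theorem its product with \<open>E\<close> is the same factor in the variable \<open>x\<close>.
\<close>

lemma transfer_symmetric:
  assumes "\<And>i k. i < Suc n \<Longrightarrow> hpoch 1 (c (Suc i) * d i) k \<noteq> 0" "\<nu> n = 0"
  shows "(\<Sum>m\<le>N. hpoch y e (N - m) / qfact (N - m) * transfer (Suc n) c d lam \<nu> x y m) =
    (\<Sum>m\<le>N. hpoch x e (N - m) / qfact (N - m) * transfer (Suc n) c d lam \<nu> y x m)"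
proof -
  have "(\<Sum>m\<le>N. hpoch y e (N - m) / qfact (N - m) * transfer (Suc n) c d lam \<nu> x y m) =
     (\<Sum>m\<le>N. \<Sum>j\<le>m. hpoch y e (N - m) / qfact (N - m) * (hpoch x y (m - j) / qfact (m - j) * transfer (Suc n) c d lam \<nu> y x j))"
    unfolding sum_distrib_left[symmetric] by (rule sum.cong[OF refl]) (simp only: transfer_exchange[of n c d \<nu> lam x y, OF assms])
  also have "\<dots> = (\<Sum>j\<le>N. \<Sum>s\<le>N - j. hpoch x y s / qfact s * (hpoch y e (N - j - s) / qfact (N - j - s)) * transfer (Suc n) c d lam \<nu> y x j)"
    unfolding sum.Sigma[OF finite_atMost ballI[OF finite_atMost]]
    by (rule sum.reindex_bij_witness[of _ "\<lambda>(j, s). (j + s, j)" "\<lambda>(m, j). (j, m - j)"]) (auto simp: mult_ac)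
  also have "\<dots> = (\<Sum>m\<le>N. hpoch x e (N - m) / qfact (N - m) * transfer (Suc n) c d lam \<nu> y x m)"
    unfolding sum_distrib_right[symmetric] q_binomial ..
  finally show ?thesis .
qed

end

section \<open>Laurent polynomials as functions\<close>

abbreviation lookup :: "('a \<Rightarrow>\<^sub>0 'b::zero) \<Rightarrow> 'a \<Rightarrow> 'b" where "lookup \<equiv> Poly_Mapping.lookup"
abbreviation keys :: "('a \<Rightarrow>\<^sub>0 'b::zero) \<Rightarrow> 'a set" where "keys \<equiv> Poly_Mapping.keys"
abbreviation single :: "'a \<Rightarrow> 'b \<Rightarrow> ('a \<Rightarrow>\<^sub>0 'b::zero)" where "single \<equiv> Poly_Mapping.single"

lemma poly_mapping_expand:
  assumes "finite A" "keys p \<subseteq> A"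
  shows "p = (\<Sum>m\<in>A. single m (lookup p m))"
proof (rule poly_mapping_eqI)
  fix k
  have "lookup (\<Sum>m\<in>A. single m (lookup p m)) k = (\<Sum>m\<in>A. lookup p m when m = k)"
    by (simp add: lookup_sum lookup_single)
  also have "\<dots> = lookup p k"
    using assms by (cases "k \<in> A") (auto simp: when_def not_in_keys_iff_lookup_eq_zero)
  finally show "lookup p k = lookup (\<Sum>m\<in>A. single m (lookup p m)) k" ..
qed

lemma poly_mapping_mult_expand:
  fixes p p' :: "('a::monoid_add) \<Rightarrow>\<^sub>0 ('b::comm_semiring_0)"
  shows "p * p' = (\<Sum>m\<in>keys p. \<Sum>m'\<in>keys p'. single (m + m') (lookup p m * lookup p' m'))"
proof -
  have "p * p' = (\<Sum>m\<in>keys p. single m (lookup p m)) * (\<Sum>m'\<in>keys p'. single m' (lookup p' m'))"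
    by (intro arg_cong2[of _ _ _ _ times] poly_mapping_expand) auto
  then show ?thesis
    by (simp add: sum_product mult_single)
qed

definition monom_value :: "(nat \<Rightarrow> complex) \<Rightarrow> (nat \<Rightarrow>\<^sub>0 int) \<Rightarrow> complex" where
  "monom_value v m = (\<Prod>i\<in>keys m. v i powi lookup m i)"

text \<open>
  Evaluation at a point with complex coordinates.  It is multiplicative at points without
  vanishing coordinates, and such points separate Laurent polynomials.  Identities
  between Laurent polynomials can thus be proved between complex numbers, where division is
  available.
\<close>

definition eval_at :: "(nat \<Rightarrow> complex) \<Rightarrow> laurent \<Rightarrow> complex" where
  "eval_at v p = (\<Sum>m\<in>keys p. lookup p m * monom_value v m)"

lemma monom_value_superset:
  "finite A \<Longrightarrow> keys m \<subseteq> A \<Longrightarrow> monom_value v m = (\<Prod>i\<in>A. v i powi lookup m i)"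
  unfolding monom_value_def by (rule prod.mono_neutral_left) (auto simp: not_in_keys_iff_lookup_eq_zero)

lemma monom_value_0 [simp]: "monom_value v 0 = 1"
  by (simp add: monom_value_def)

lemma monom_value_add:
  assumes "\<And>i. v i \<noteq> 0"
  shows "monom_value v (m + m') = monom_value v m * monom_value v m'"
proof -
  let ?A = "keys m \<union> keys m'"
  have "monom_value v (m + m') = (\<Prod>i\<in>?A. v i powi lookup (m + m') i)"
    using keys_add[of m m'] by (intro monom_value_superset) auto
  also have "\<dots> = (\<Prod>i\<in>?A. v i powi lookup m i) * (\<Prod>i\<in>?A. v i powi lookup m' i)"
    using assms by (simp add: lookup_add power_int_add prod.distrib)
  also have "\<dots> = monom_value v m * monom_value v m'"
    by (simp add: monom_value_superset[of ?A])
  finally show ?thesis .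
qed

lemma monom_value_single: "monom_value v (single i k) = v i powi k"
  by (cases "k = 0") (simp_all add: monom_value_def)

lemma eval_at_superset:
  "finite A \<Longrightarrow> keys p \<subseteq> A \<Longrightarrow> eval_at v p = (\<Sum>m\<in>A. lookup p m * monom_value v m)"
  unfolding eval_at_def by (rule sum.mono_neutral_left) (auto simp: not_in_keys_iff_lookup_eq_zero)

lemma eval_at_0 [simp]: "eval_at v 0 = 0"
  by (simp add: eval_at_def)

lemma eval_at_single [simp]: "eval_at v (single m c) = c * monom_value v m"
  by (cases "c = 0") (simp_all add: eval_at_def)

lemma eval_at_add [simp]: "eval_at v (p + p') = eval_at v p + eval_at v p'"
proof -
  let ?A = "keys p \<union> keys p'"
  have "eval_at v (p + p') = (\<Sum>m\<in>?A. lookup (p + p') m * monom_value v m)"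
    using keys_add[of p p'] by (intro eval_at_superset) auto
  also have "\<dots> = eval_at v p + eval_at v p'"
    by (simp add: lookup_add distrib_right sum.distrib eval_at_superset[of ?A])
  finally show ?thesis .
qed

lemma eval_at_sum [simp]: "eval_at v (sum f A) = (\<Sum>a\<in>A. eval_at v (f a))"
  by (induction A rule: infinite_finite_induct) auto

lemma eval_at_mult:
  assumes "\<And>i. v i \<noteq> 0"
  shows "eval_at v (p * p') = eval_at v p * eval_at v p'"
  unfolding poly_mapping_mult_expand
  by (simp add: monom_value_add[OF assms] eval_at_def[of v p] eval_at_def[of v p'] sum_product mult_ac)

lemma eval_at_1 [simp]: "eval_at v 1 = 1"
  using eval_at_single[of v 0 1] by simp

lemma eval_at_prod:
  assumes "\<And>i. v i \<noteq> 0"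
  shows "eval_at v (prod f A) = (\<Prod>a\<in>A. eval_at v (f a))"
  by (induction A rule: infinite_finite_induct) (auto simp: eval_at_mult[OF assms])

lemma eval_at_Const [simp]: "eval_at v (Const c) = c"
  by (simp add: Const_def)

lemma eval_at_X [simp]: "eval_at v (X i) = v i"
  by (simp add: X_def monom_value_single)

lemma eval_at_diff [simp]: "eval_at v (p - p') = eval_at v p - eval_at v p'"
proof -
  have "eval_at v p = eval_at v (p - p' + p')" by simp
  then show ?thesis by (simp only: eval_at_add) simp
qed

text \<open>
  Dedekind's argument for the independence of characters: two distinct monomials scale
  differently when a suitable coordinate is doubled, so one monomial can be eliminated from a
  vanishing combination.
\<close>

lemma monom_values_independent:
  assumes "finite S" "\<And>v. (\<And>i. v i \<noteq> 0) \<Longrightarrow> (\<Sum>m\<in>S. c m * monom_value v m) = 0" "m \<in> S"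
  shows "c m = 0"
  using assms
proof (induction S arbitrary: c m rule: finite_induct)
  case (insert m0 S)
  have S: "c m1 = 0" if m1: "m1 \<in> S" for m1
  proof -
    have "m0 \<noteq> m1" using m1 insert.hyps by auto
    then obtain i where i: "lookup m0 i \<noteq> lookup m1 i"
      by (metis poly_mapping_eqI)
    have scale: "monom_value (v(i := 2 * v i)) m = 2 powi lookup m i * monom_value v m" for v m
    proof -
      have "monom_value (v(i := 2 * v i)) m = (\<Prod>j\<in>insert i (keys m). (v(i := 2 * v i)) j powi lookup m j)"
        by (rule monom_value_superset) auto
      also have "\<dots> = 2 powi lookup m i * (\<Prod>j\<in>insert i (keys m). v j powi lookup m j)"
        by (subst (1 2) prod.insert_remove) (auto simp: power_int_mult_distrib intro!: prod.cong)
      also have "(\<Prod>j\<in>insert i (keys m). v j powi lookup m j) = monom_value v m"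
        by (rule monom_value_superset[symmetric]) auto
      finally show ?thesis .
    qed
    have "c m1 * (2 powi lookup m1 i - 2 powi lookup m0 i) = 0"
    proof (rule insert.IH[where c = "\<lambda>m. c m * (2 powi lookup m i - 2 powi lookup m0 i)", OF _ m1])
      fix v :: "nat \<Rightarrow> complex" assume v: "\<And>i. v i \<noteq> 0"
      have "(\<Sum>m\<in>insert m0 S. c m * monom_value (v(i := 2 * v i)) m) = 0"
        by (rule insert.prems) (use v in auto)
      moreover have "2 powi lookup m0 i * (\<Sum>m\<in>insert m0 S. c m * monom_value v m) = 0"
        using insert.prems(1)[of v] v by simp
      ultimately have "(\<Sum>m\<in>insert m0 S. c m * (2 powi lookup m i - 2 powi lookup m0 i) * monom_value v m) = 0"
        unfolding scale by (simp add: sum_distrib_left algebra_simps sum_subtractf del: sum.insert)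
      then show "(\<Sum>m\<in>S. c m * (2 powi lookup m i - 2 powi lookup m0 i) * monom_value v m) = 0"
        using insert.hyps by simp
    qed
    moreover have "(2::complex) powi lookup m1 i \<noteq> 2 powi lookup m0 i"
    proof
      assume "(2::complex) powi lookup m1 i = 2 powi lookup m0 i"
      then have "norm ((2::complex) powi lookup m1 i) = norm ((2::complex) powi lookup m0 i)" by simp
      then have "(2::real) powi lookup m1 i = 2 powi lookup m0 i" by (simp add: norm_power_int)
      then show False
        using i power_int_strict_increasing[of "lookup m0 i" "lookup m1 i" "2::real"]
          power_int_strict_increasing[of "lookup m1 i" "lookup m0 i" "2::real"] by (auto simp: neq_iff)
    qed
    ultimately show ?thesis by simp
  qed
  have "c m0 * monom_value (\<lambda>_. 1) m0 = 0"
    using insert.prems(1)[of "\<lambda>_. 1"] insert.hyps S by simp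
  then have "c m0 = 0" by (simp add: monom_value_def)
  with S insert.prems show ?case by auto
qed simp

lemma laurent_eqI:
  assumes "\<And>v. (\<And>i. v i \<noteq> 0) \<Longrightarrow> eval_at v p = eval_at v p'"
  shows "p = p'"
proof (rule poly_mapping_eqI)
  fix m
  have "lookup (p - p') m = 0"
  proof (cases "m \<in> keys (p - p')")
    case True
    then show ?thesis
      using monom_values_independent[of "keys (p - p')" "lookup (p - p')" m] assms
      by (simp add: eval_at_def[symmetric])
  qed (simp add: not_in_keys_iff_lookup_eq_zero)
  then show "lookup p m = lookup p' m" by (simp add: lookup_minus)
qed

lemma lookup_map_key: "inj f \<Longrightarrow> lookup (Poly_Mapping.map_key f m) i = lookup m (f i)"
  by (simp add: Poly_Mapping.map_key.rep_eq)

lemma monom_value_map_key: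
  assumes "bij \<pi>"
  shows "monom_value v (Poly_Mapping.map_key \<pi> m) = monom_value (v \<circ> inv \<pi>) m"
proof -
  have inj: "inj \<pi>" using assms by (rule bij_is_inj)
  have "monom_value v (Poly_Mapping.map_key \<pi> m) = (\<Prod>i\<in>\<pi> -` keys m. v i powi lookup m (\<pi> i))"
    by (simp add: monom_value_def keys_map_key[OF inj] lookup_map_key[OF inj])
  also have "\<dots> = (\<Prod>j\<in>keys m. (v \<circ> inv \<pi>) j powi lookup m j)"
    by (rule prod.reindex_bij_witness[of _ "inv \<pi>" \<pi>])
       (use assms in \<open>auto simp: bij_is_inj bij_is_surj surj_f_inv_f inv_f_f\<close>)
  finally show ?thesis by (simp add: monom_value_def)
qed

lemma map_key_inverse:
  assumes "bij \<pi>"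
  shows "Poly_Mapping.map_key \<pi> (Poly_Mapping.map_key (inv \<pi>) m) = m"
  using assms bij_imp_bij_inv[OF assms]
  by (intro poly_mapping_eqI) (simp add: lookup_map_key bij_is_inj bij_is_surj surj_f_inv_f inv_f_f)

text \<open>
  Invariance under a permutation of the exponents is the same as invariance of the values under
  that permutation of the coordinates.
\<close>

lemma symmetric_iff_eval_at:
  assumes "bij \<pi>"
  shows "(\<forall>m. lookup p (Poly_Mapping.map_key \<pi> m) = lookup p m) \<longleftrightarrow>
     (\<forall>v. (\<forall>i. v i \<noteq> 0) \<longrightarrow> eval_at (v \<circ> \<pi>) p = eval_at v p)"
proof -
  have inv: "bij (inv \<pi>)" using assms by (rule bij_imp_bij_inv)
  have inj: "inj (Poly_Mapping.map_key \<pi> :: (nat \<Rightarrow>\<^sub>0 int) \<Rightarrow> _)"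
    by (rule inj_on_inverseI[of _ "Poly_Mapping.map_key (inv \<pi>)"])
       (use map_key_inverse[OF inv] in \<open>simp add: inv_inv_eq[OF assms]\<close>)
  define p' where "p' = Poly_Mapping.map_key (Poly_Mapping.map_key \<pi>) p"
  have lookup: "lookup p' m = lookup p (Poly_Mapping.map_key \<pi> m)" for m
    unfolding p'_def by (rule lookup_map_key[OF inj])
  have k: "Poly_Mapping.map_key \<pi> (Poly_Mapping.map_key (inv \<pi>) m) = m"
     "Poly_Mapping.map_key (inv \<pi>) (Poly_Mapping.map_key \<pi> m) = m" for m :: "nat \<Rightarrow>\<^sub>0 int"
    using map_key_inverse[OF assms] map_key_inverse[OF inv] by (simp_all add: inv_inv_eq[OF assms])
  have eval_at: "eval_at v p' = eval_at (v \<circ> \<pi>) p" for v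
  proof -
    have "eval_at v p' = (\<Sum>m\<in>Poly_Mapping.map_key \<pi> -` keys p. lookup p (Poly_Mapping.map_key \<pi> m) * monom_value v m)"
      unfolding eval_at_def lookup by (simp add: p'_def keys_map_key[OF inj])
    also have "\<dots> = (\<Sum>m\<in>keys p. lookup p m * monom_value (v \<circ> \<pi>) m)"
      by (rule sum.reindex_bij_witness[of _ "Poly_Mapping.map_key (inv \<pi>)" "Poly_Mapping.map_key \<pi>"])
         (auto simp: k monom_value_map_key[OF assms] o_assoc[symmetric]
            surj_iff[THEN iffD1, OF bij_is_surj[OF assms]] inv_o_cancel[OF bij_is_inj[OF assms]])
    finally show ?thesis by (simp add: eval_at_def)
  qed
  have "(\<forall>m. lookup p' m = lookup p m) \<longleftrightarrow> p' = p"
    by (auto intro: poly_mapping_eqI)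
  also have "\<dots> \<longleftrightarrow> (\<forall>v. (\<forall>i. v i \<noteq> 0) \<longrightarrow> eval_at (v \<circ> \<pi>) p = eval_at v p)"
    using laurent_eqI[of p' p] unfolding eval_at[symmetric] by auto
  finally show ?thesis by (simp add: lookup)
qed

section \<open>Bounded exponents and setting a variable to zero\<close>

text \<open>
  Polynomials whose degree in the variable \<open>i\<close> is at most \<open>N i\<close>.  The bound for each variable
  separately also records which variables occur.
\<close>

definition box :: "(nat \<Rightarrow> nat) \<Rightarrow> laurent set" where
  "box N = {p. \<forall>m\<in>keys p. \<forall>i. 0 \<le> lookup m i \<and> lookup m i \<le> int (N i)}"

lemma box_mono: "p \<in> box N \<Longrightarrow> (\<And>i. N i \<le> M i) \<Longrightarrow> p \<in> box M"
  unfolding box_def by (blast intro: order_trans[OF _ of_nat_mono])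

lemma box_0 [simp]: "0 \<in> box N"
  by (simp add: box_def)

lemma box_Const [simp]: "Const c \<in> box N"
  by (auto simp: box_def Const_def)

lemma box_1 [simp]: "1 \<in> box N"
  by (auto simp: box_def)

lemma box_X: "N v \<ge> 1 \<Longrightarrow> X v \<in> box N"
  by (auto simp: box_def X_def lookup_single when_def)

lemma box_add: "p \<in> box N \<Longrightarrow> p' \<in> box N \<Longrightarrow> p + p' \<in> box N"
  using keys_add[of p p'] by (auto simp: box_def)

lemma box_diff: "p \<in> box N \<Longrightarrow> p' \<in> box N \<Longrightarrow> p - p' \<in> box N"
  using keys_diff[of p p'] by (auto simp: box_def)

lemma box_sum: "(\<And>a. a \<in> A \<Longrightarrow> f a \<in> box N) \<Longrightarrow> sum f A \<in> box N"
  by (induction A rule: infinite_finite_induct) (auto intro: box_add)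

lemma box_mult: "p \<in> box N \<Longrightarrow> p' \<in> box M \<Longrightarrow> p * p' \<in> box (\<lambda>i. N i + M i)"
proof -
  assume p: "p \<in> box N" "p' \<in> box M"
  show "p * p' \<in> box (\<lambda>i. N i + M i)"
    unfolding box_def
  proof safe
    fix m i assume "m \<in> keys (p * p')"
    then obtain a b where m: "m = a + b" and ab: "a \<in> keys p" "b \<in> keys p'"
      using keys_mult[of p p'] by blast
    have "0 \<le> lookup a i" "lookup a i \<le> int (N i)" "0 \<le> lookup b i" "lookup b i \<le> int (M i)"
      using p ab by (auto simp: box_def)
    then show "0 \<le> lookup m i" "lookup m i \<le> int (N i + M i)"
      by (simp_all add: m lookup_add)
  qed
qed

lemma box_prod: "(\<And>a. a \<in> A \<Longrightarrow> f a \<in> box (N a)) \<Longrightarrow> prod f A \<in> box (\<lambda>i. \<Sum>a\<in>A. N a i)"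
proof (induction A rule: infinite_finite_induct)
  case (insert a A)
  then show ?case
    using box_mult[of "f a" "N a" "prod f A" "\<lambda>i. \<Sum>a\<in>A. N a i"] by simp
qed auto

text \<open>
  The substitution of \<open>0\<close> for the variable \<open>v\<close>, as an operation on all Laurent polynomials:
  the terms without \<open>v\<close> are kept.  It is multiplicative only where no negative exponents occur.
\<close>

definition zero_at :: "nat \<Rightarrow> laurent \<Rightarrow> laurent" where
  "zero_at v p = (\<Sum>m\<in>keys p. if lookup m v = 0 then single m (lookup p m) else 0)"

lemma lookup_zero_at: "lookup (zero_at v p) m = (if lookup m v = 0 then lookup p m else 0)"
proof -
  have "lookup (zero_at v p) m = (\<Sum>m'\<in>keys p. if m' = m then (if lookup m v = 0 then lookup p m else 0) else 0)"
    unfolding zero_at_def lookup_sum by (rule sum.cong) (auto simp: lookup_single)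
  then show ?thesis
    by (simp add: not_in_keys_iff_lookup_eq_zero)
qed

lemma zero_at_add [simp]: "zero_at v (p + p') = zero_at v p + zero_at v p'"
  by (rule poly_mapping_eqI) (simp add: lookup_zero_at lookup_add)

lemma zero_at_diff [simp]: "zero_at v (p - p') = zero_at v p - zero_at v p'"
  by (rule poly_mapping_eqI) (simp add: lookup_zero_at lookup_minus)

lemma zero_at_0 [simp]: "zero_at v 0 = 0"
  by (simp add: zero_at_def)

lemma zero_at_sum [simp]: "zero_at v (sum f A) = (\<Sum>a\<in>A. zero_at v (f a))"
  by (induction A rule: infinite_finite_induct) auto

lemma zero_at_single: "zero_at v (single m c) = (if lookup m v = 0 then single m c else 0)"
  by (cases "c = 0") (auto simp: zero_at_def)

lemma zero_at_Const [simp]: "zero_at v (Const c) = Const c"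
  by (simp add: Const_def zero_at_single)

lemma zero_at_X [simp]: "zero_at v (X v) = 0"
  by (simp add: X_def zero_at_single)

lemma zero_at_1 [simp]: "zero_at v 1 = 1"
  using zero_at_single[of v 0 1] by simp

lemma zero_at_id: "p \<in> box N \<Longrightarrow> N v = 0 \<Longrightarrow> zero_at v p = p"
proof (rule poly_mapping_eqI)
  fix m
  assume p: "p \<in> box N" "N v = 0"
  have "lookup m v = 0" if "m \<in> keys p"
    using p that by (auto simp: box_def intro!: antisym) (metis of_nat_0)
  then show "lookup (zero_at v p) m = lookup p m"
    by (auto simp: lookup_zero_at in_keys_iff)
qed

lemma zero_at_mult:
  assumes "p \<in> box N" "p' \<in> box N'"
  shows "zero_at v (p * p') = zero_at v p * zero_at v p'"
proof -
  have "zero_at v (single (m + m') (lookup p m * lookup p' m')) =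
     (if lookup m v = 0 then single m (lookup p m) else 0) * (if lookup m' v = 0 then single m' (lookup p' m') else 0)"
    if "m \<in> keys p" "m' \<in> keys p'" for m m'
  proof -
    have "0 \<le> lookup m v" "0 \<le> lookup m' v"
      using that assms by (auto simp: box_def)
    then show ?thesis by (auto simp: zero_at_single lookup_add mult_single)
  qed
  then have "zero_at v (p * p') = (\<Sum>m\<in>keys p. \<Sum>m'\<in>keys p'.
     (if lookup m v = 0 then single m (lookup p m) else 0) * (if lookup m' v = 0 then single m' (lookup p' m') else 0))"
    unfolding poly_mapping_mult_expand zero_at_sum by (intro sum.cong refl) blast
  then show ?thesis
    by (simp only: zero_at_def sum_product)
qed

lemma zero_at_prod:
  assumes "\<And>a. a \<in> A \<Longrightarrow> f a \<in> box (N a)"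
  shows "zero_at v (prod f A) = (\<Prod>a\<in>A. zero_at v (f a))"
  using assms
proof (induction A rule: infinite_finite_induct)
  case (insert a A)
  have "zero_at v (f a * prod f A) = zero_at v (f a) * zero_at v (prod f A)"
    by (rule zero_at_mult[OF _ box_prod]) (use insert in auto)
  then show ?case using insert by simp
qed auto

lemma Const_mult: "Const (a * b) = Const a * Const b"
  by (simp add: Const_def mult_single)

lemma Const_diff: "Const (a - b) = Const a - Const b"
  by (simp add: Const_def single_diff)

lemma Const_1 [simp]: "Const 1 = 1"
  by (simp add: Const_def)

lemma Const_0 [simp]: "Const 0 = 0"
  by (simp add: Const_def)

lemma Const_power: "Const (a ^ k) = Const a ^ k"
  by (induction k) (simp_all add: Const_mult)

lemma Const_prod: "Const (prod f A) = (\<Prod>a\<in>A. Const (f a))"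
  by (induction A rule: infinite_finite_induct) (simp_all add: Const_mult)

section \<open>The branching weights as polynomials\<close>

definition lin_c :: "complex \<Rightarrow> nat \<Rightarrow> complex \<Rightarrow> nat \<Rightarrow> laurent" where
  "lin_c q v c k = (\<Prod>i<k. X v - Const (c * q ^ i))"

definition lin_d :: "complex \<Rightarrow> nat \<Rightarrow> complex \<Rightarrow> nat \<Rightarrow> laurent" where
  "lin_d q v d k = (\<Prod>i<k. 1 - Const (d * q ^ i) * X v)"

definition skew_coeff :: "complex \<Rightarrow> (nat \<Rightarrow> complex) \<Rightarrow> (nat \<Rightarrow> complex) \<Rightarrow> (nat \<Rightarrow> nat) \<Rightarrow> (nat \<Rightarrow> nat) \<Rightarrow> nat \<Rightarrow> complex" where
  "skew_coeff q c d lam \<mu> r = qpoch q q (lam r - lam (Suc r)) /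
                 (qpoch q q (lam r - \<mu> r) * qpoch q q (\<mu> r - lam (Suc r)) *
                  qpoch (c r * d r) q (lam r - lam (Suc r)))"

lemma lin_c_eq: "X v ^ k * qpoch (Const c * Xinv v) (Const q) k = lin_c q v c k"
proof -
  have "X v * (1 - Const c * Xinv v * Const q ^ i) = X v - Const (c * q ^ i)" for i
  proof -
    have "X v * (1 - Const c * Xinv v * Const q ^ i) = X v - (X v * Xinv v) * Const (c * q ^ i)"
      by (simp add: Const_mult Const_power algebra_simps)
    then show ?thesis by (simp add: X_mult_Xinv)
  qed
  then have "lin_c q v c k = (\<Prod>i<k. X v * (1 - Const c * Xinv v * Const q ^ i))"
    unfolding lin_c_def by (simp only:)
  then show ?thesis
    by (simp add: qpoch_def prod.distrib)
qed

lemma lin_d_eq: "qpoch (X v * Const d) (Const q) k = lin_d q v d k"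
  unfolding qpoch_def lin_d_def by (simp add: Const_mult Const_power mult_ac)

text \<open>
  The power of the variable in front distributes over the parts and turns the factors \<open>1 - c q\<^sup>i / x\<close>
  into \<open>x - c q\<^sup>i\<close>, which shows that the branching weights are polynomials.
\<close>

lemma spinW_skew_eq:
  assumes "\<mu> \<preceq> lam"
  shows "spinW_skew q n c d lam \<mu> v =
    (\<Prod>r<n. lin_c q v (c r) (lam r - \<mu> r) * lin_d q v (d r) (\<mu> r - lam (Suc r)) * Const (skew_coeff q c d lam \<mu> r))"
proof -
  have le: "\<mu> i \<le> lam i" for i using assms by (simp add: interlaces_def)
  have "(\<Sum>i<n. lam i) - (\<Sum>i<n. \<mu> i) = (\<Sum>i<n. lam i - \<mu> i)"
    using le by (simp add: sum_subtractf_nat)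
  then have "X v ^ ((\<Sum>i<n. lam i) - (\<Sum>i<n. \<mu> i)) = (\<Prod>i<n. X v ^ (lam i - \<mu> i))"
    by (simp add: power_sum)
  then show ?thesis
    using assms unfolding spinW_skew_def lin_c_eq[symmetric] lin_d_eq[symmetric] skew_coeff_def
    by (simp add: prod.distrib[symmetric] mult_ac)
qed

lemma eval_at_lin_c:
  assumes "\<And>i. v i \<noteq> 0"
  shows "eval_at v (lin_c q j c k) = (\<Prod>i<k. v j - c * q ^ i)"
  by (simp add: lin_c_def eval_at_prod[OF assms])

lemma eval_at_lin_d:
  assumes "\<And>i. v i \<noteq> 0"
  shows "eval_at v (lin_d q j d k) = (\<Prod>i<k. 1 - v j * d * q ^ i)"
  by (simp add: lin_d_def eval_at_prod[OF assms] eval_at_mult[OF assms] mult_ac)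

lemma box_lin_c: "lin_c q v c k \<in> box (\<lambda>i. if i = v then k else 0)"
proof -
  have "lin_c q v c k \<in> box (\<lambda>i. \<Sum>a<k. if i = v then 1 else 0)"
    unfolding lin_c_def by (rule box_prod, rule box_diff) (auto intro: box_X)
  then show ?thesis by (rule box_mono) auto
qed

lemma box_lin_d: "lin_d q v d k \<in> box (\<lambda>i. if i = v then k else 0)"
proof -
  have "Const e * X v \<in> box (\<lambda>i. if i = v then 1 else 0)" for e
    using box_mult[OF box_Const[of e "\<lambda>_. 0"] box_X[of "\<lambda>i. if i = v then 1 else 0"]] by simp
  then have "lin_d q v d k \<in> box (\<lambda>i. \<Sum>a<k. if i = v then 1 else 0)"
    unfolding lin_d_def by (intro box_prod box_diff) auto
  then show ?thesis by (rule box_mono) auto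
qed

text \<open>
  The degrees \<open>\<lambda>\<^sub>r - \<mu>\<^sub>r\<close> and \<open>\<mu>\<^sub>r - \<lambda>\<^sub>r\<^sub>+\<^sub>1\<close> of the factors telescope to \<open>\<lambda>\<^sub>0\<close>.
\<close>

lemma box_spinW_skew:
  assumes "\<mu> \<preceq> lam" "lam n = 0"
  shows "spinW_skew q n c d lam \<mu> v \<in> box (\<lambda>i. if i = v then lam 0 else 0)"
proof -
  have le: "lam (Suc r) \<le> \<mu> r" "\<mu> r \<le> lam r" for r
    using assms by (auto simp: interlaces_def)
  have "spinW_skew q n c d lam \<mu> v \<in> box (\<lambda>i. \<Sum>r<n. (if i = v then lam r - \<mu> r else 0) + (if i = v then \<mu> r - lam (Suc r) else 0) + 0)"
    unfolding spinW_skew_eq[OF assms(1)]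
    by (intro box_prod box_mult box_lin_c box_lin_d box_Const)
  moreover have "(\<Sum>r<n. (lam r - \<mu> r) + (\<mu> r - lam (Suc r))) = lam 0"
  proof -
    have "(\<Sum>r<k. (lam r - \<mu> r) + (\<mu> r - lam (Suc r))) + lam k = lam 0" for k
    proof (induction k)
      case (Suc k)
      then show ?case using le[of k] by simp
    qed simp
    from this[of n] show ?thesis using assms(2) by simp
  qed
  ultimately show ?thesis
    by (rule_tac box_mono) auto
qed

lemma Y_interlaces_0: "\<mu> \<preceq> lam \<Longrightarrow> \<mu> 0 \<le> lam 0"
  by (simp add: interlaces_def)

lemma box_spinW:
  assumes "lam \<in> Y n"
  shows "spinW q n c d lam \<in> box (\<lambda>i. if i < n then lam 0 else 0)"
  using assms
proof (induction n arbitrary: c lam)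
  case (Suc n)
  have "spinW q n (\<lambda>i. c (Suc i)) d \<mu> * spinW_skew q (Suc n) c d lam \<mu> n \<in> box (\<lambda>i. if i < Suc n then lam 0 else 0)"
    if \<mu>: "\<mu> \<in> Y n" "\<mu> \<preceq> lam" for \<mu>
  proof -
    have "spinW q n (\<lambda>i. c (Suc i)) d \<mu> * spinW_skew q (Suc n) c d lam \<mu> n
      \<in> box (\<lambda>i. (if i < n then \<mu> 0 else 0) + (if i = n then lam 0 else 0))"
      using \<mu> Suc.prems by (intro box_mult Suc.IH box_spinW_skew) (auto simp: Y_def)
    then show ?thesis
      using Y_interlaces_0[OF \<mu>(2)] by (rule_tac box_mono) auto
  qed
  then show ?case
    by (auto intro: box_sum)
qed auto

section \<open>Symmetry of the spin q-Whittaker polynomials\<close>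

lemma Y_0: "Y 0 = {\<lambda>_. 0}"
  by (auto simp: Y_def monotone_on_def)

lemma finite_Y_bounded: "finite {\<mu> \<in> Y n. \<mu> 0 \<le> N}"
proof (rule finite_subset)
  have "\<mu> i \<le> N" if "antimono \<mu>" "\<mu> 0 \<le> N" for \<mu> :: "nat \<Rightarrow> nat" and i
    using that antimonoD[of \<mu> 0 i] by simp
  then show "{\<mu> \<in> Y n. \<mu> 0 \<le> N} \<subseteq> {\<mu>. \<forall>i. (i \<in> {..<n} \<longrightarrow> \<mu> i \<in> {..N}) \<and> (i \<notin> {..<n} \<longrightarrow> \<mu> i = 0)}"
    by (auto simp: Y_def)
qed (rule finite_set_of_finite_funs; simp)

lemma Y_tail: "\<mu> \<in> Y (Suc n) \<Longrightarrow> (\<lambda>i. \<mu> (Suc i)) \<in> Y n"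
  by (auto simp: Y_def monotone_on_def)

lemma Y_case_nat: "\<mu> \<in> Y n \<Longrightarrow> \<mu> 0 \<le> m \<Longrightarrow> case_nat m \<mu> \<in> Y (Suc n)"
  by (auto simp: Y_def antimono_iff_le_Suc split: nat.split)

context q_calculus
begin

text \<open>
  The recursion for the transfer sum peels off the largest part of \<open>\<mu>\<close>.
\<close>

lemma transfer_eq_sum:
  "transfer n c d lam \<nu> x y m =
     (\<Sum>\<mu> \<in> {\<mu> \<in> Y n. \<mu> 0 = m}. \<Prod>r<n. column_weight (c (Suc r)) (d r) (lam (Suc r)) (\<nu> r) x y (\<mu> r) (\<mu> (Suc r)))"
proof (induction n arbitrary: c d lam \<nu> m)
  case 0
  have "{\<mu> \<in> Y 0. \<mu> 0 = m} = (if m = 0 then {\<lambda>_. 0} else {})"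
    by (auto simp: Y_0)
  then show ?case by simp
next
  case (Suc n)
  have fin: "finite {\<mu> \<in> Y n. \<mu> 0 = m'}" for m'
    by (rule finite_subset[OF _ finite_Y_bounded[of n m']]) auto
  have "transfer (Suc n) c d lam \<nu> x y m =
     (\<Sum>m'\<le>m. \<Sum>\<mu> \<in> {\<mu> \<in> Y n. \<mu> 0 = m'}. column_weight (c 1) (d 0) (lam 1) (\<nu> 0) x y m m' *
        (\<Prod>r<n. column_weight (c (Suc (Suc r))) (d (Suc r)) (lam (Suc (Suc r))) (\<nu> (Suc r)) x y (\<mu> r) (\<mu> (Suc r))))"
    by (simp add: Suc.IH sum_distrib_left)
  also have "\<dots> = (\<Sum>\<mu> \<in> {\<mu> \<in> Y (Suc n). \<mu> 0 = m}. \<Prod>r<Suc n. column_weight (c (Suc r)) (d r) (lam (Suc r)) (\<nu> r) x y (\<mu> r) (\<mu> (Suc r)))"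
    unfolding sum.Sigma[OF finite_atMost ballI[OF fin]] prod.lessThan_Suc_shift
  proof (rule sum.reindex_bij_witness[of _ "\<lambda>\<mu>. (\<mu> 1, \<lambda>i. \<mu> (Suc i))" "\<lambda>(m', \<mu>). case_nat m \<mu>"], goal_cases)
    case (3 \<mu>)
    then show ?case by (auto simp: fun_eq_iff split: nat.split)
  next
    case (4 \<mu>)
    then have "\<mu> 1 \<le> \<mu> 0"
      by (auto simp: Y_def intro: antimonoD)
    with 4 Y_tail[of \<mu> n] show ?case by auto
  qed (auto intro: Y_case_nat)
  finally show ?case .
qed

end

locale spin_whittaker =
  fixes q :: complex
  assumes norm_q: "norm q < 1"
begin

sublocale q_calculus q
proof
  fix k :: nat assume "k > 0"
  then have "norm (q ^ k) < 1"
    using norm_q by (simp add: norm_power power_less_one_iff)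
  then show "q ^ k \<noteq> 1" by auto
qed

lemma qpoch_eq_hpoch: "qpoch z q k = hpoch 1 z k"
  by (simp add: qpoch_def hpoch_def)

text \<open>
  The denominators \<open>(c\<^sub>i d\<^sub>j;q)\<^sub>k\<close> occurring at the different levels of the branching rule: at each
  level the sequence \<open>c\<close> is shifted by one while \<open>d\<close> is not, so exactly the pairs with \<open>j \<le> i\<close>
  occur.
\<close>

definition nonsingular :: "nat \<Rightarrow> (nat \<Rightarrow> complex) \<Rightarrow> (nat \<Rightarrow> complex) \<Rightarrow> bool" where
  "nonsingular n c d \<longleftrightarrow> (\<forall>i<n. \<forall>j\<le>i. \<forall>k. hpoch 1 (c i * d j) k \<noteq> 0)"

lemma nonsingular_shift: "nonsingular (Suc n) c d \<Longrightarrow> nonsingular n (\<lambda>i. c (Suc i)) d"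
  by (auto simp: nonsingular_def)

definition row_weight :: "nat \<Rightarrow> (nat \<Rightarrow> complex) \<Rightarrow> (nat \<Rightarrow> complex) \<Rightarrow> (nat \<Rightarrow> nat) \<Rightarrow> (nat \<Rightarrow> nat) \<Rightarrow> complex \<Rightarrow> complex" where
  "row_weight n c d lam \<mu> x = (\<Prod>r<n. hpoch x (c r) (lam r - \<mu> r) * hpoch 1 (x * d r) (\<mu> r - lam (Suc r)) *
     skew_coeff q c d lam \<mu> r)"

lemma eval_at_spinW_skew:
  assumes "\<And>i. v i \<noteq> 0" "\<mu> \<preceq> lam"
  shows "eval_at v (spinW_skew q n c d lam \<mu> j) = row_weight n c d lam \<mu> (v j)"
  unfolding spinW_skew_eq[OF assms(2)] row_weight_def
  by (simp add: eval_at_prod[OF assms(1)] eval_at_mult[OF assms(1)] eval_at_lin_c[OF assms(1)] eval_at_lin_d[OF assms(1)] hpoch_def)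

lemma eval_at_spinW_Suc:
  assumes "\<And>i. v i \<noteq> 0"
  shows "eval_at v (spinW q (Suc n) c d lam) =
    (\<Sum>\<mu>\<in>{\<mu> \<in> Y n. \<mu> \<preceq> lam}. eval_at v (spinW q n (\<lambda>i. c (Suc i)) d \<mu>) * row_weight (Suc n) c d lam \<mu> (v n))"
  by (simp add: eval_at_mult[OF assms] eval_at_spinW_skew[OF assms])

text \<open>
  Regrouping the factors of two rows by columns.  The interlacing conditions need not be imposed on
  \<open>\<mu>\<close> in the transfer sum, because a column weight vanishes as soon as one of them fails.
\<close>

lemma two_rows_eq_transfer:
  assumes "lam \<in> Y (Suc (Suc n))" "\<nu> \<in> Y n"
  shows "(\<Sum>\<mu> \<in> {\<mu> \<in> Y (Suc n). \<nu> \<preceq> \<mu> \<and> \<mu> \<preceq> lam}.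
       row_weight (Suc n) (\<lambda>i. c (Suc i)) d \<mu> \<nu> x * row_weight (Suc (Suc n)) c d lam \<mu> y) =
    (\<Prod>r<Suc (Suc n). qfact (lam r - lam (Suc r)) / hpoch 1 (c r * d r) (lam r - lam (Suc r))) *
    (\<Sum>m\<le>lam 0. hpoch y (c 0) (lam 0 - m) / qfact (lam 0 - m) * transfer (Suc n) c d lam \<nu> x y m)"
    (is "?lhs = ?K * ?rhs")
proof -
  let ?w = "\<lambda>\<mu>. hpoch y (c 0) (lam 0 - \<mu> 0) / qfact (lam 0 - \<mu> 0) *
     (\<Prod>r<Suc n. column_weight (c (Suc r)) (d r) (lam (Suc r)) (\<nu> r) x y (\<mu> r) (\<mu> (Suc r)))"
  have fin: "finite {\<mu> \<in> Y (Suc n). \<mu> 0 = m'}" for m'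
    by (rule finite_subset[OF _ finite_Y_bounded[of "Suc n" m']]) auto
  have "?rhs = (\<Sum>m\<le>lam 0. \<Sum>\<mu> \<in> {\<mu> \<in> Y (Suc n). \<mu> 0 = m}. ?w \<mu>)"
    unfolding transfer_eq_sum sum_distrib_left by (intro sum.cong refl) auto
  also have "\<dots> = (\<Sum>\<mu> \<in> {\<mu> \<in> Y (Suc n). \<mu> 0 \<le> lam 0}. ?w \<mu>)"
    unfolding sum.Sigma[OF finite_atMost ballI[OF fin]]
    by (rule sum.reindex_bij_witness[of _ "\<lambda>\<mu>. (\<mu> 0, \<mu>)" snd]) auto
  also have "\<dots> = (\<Sum>\<mu> \<in> {\<mu> \<in> Y (Suc n). \<nu> \<preceq> \<mu> \<and> \<mu> \<preceq> lam}. ?w \<mu>)"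
  proof (rule sum.mono_neutral_right[OF finite_Y_bounded])
    show "{\<mu> \<in> Y (Suc n). \<nu> \<preceq> \<mu> \<and> \<mu> \<preceq> lam} \<subseteq> {\<mu> \<in> Y (Suc n). \<mu> 0 \<le> lam 0}"
      by (auto simp: interlaces_def)
    show "\<forall>\<mu>\<in>{\<mu> \<in> Y (Suc n). \<mu> 0 \<le> lam 0} - {\<mu> \<in> Y (Suc n). \<nu> \<preceq> \<mu> \<and> \<mu> \<preceq> lam}. ?w \<mu> = 0"
    proof
      fix \<mu> assume \<mu>: "\<mu> \<in> {\<mu> \<in> Y (Suc n). \<mu> 0 \<le> lam 0} - {\<mu> \<in> Y (Suc n). \<nu> \<preceq> \<mu> \<and> \<mu> \<preceq> lam}"
      have "\<exists>r<Suc n. \<not> (lam (Suc r) \<le> \<mu> r \<and> \<nu> r \<le> \<mu> r \<and> \<mu> (Suc r) \<le> \<nu> r \<and> \<mu> (Suc r) \<le> lam (Suc r))"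
      proof (rule ccontr)
        assume "\<not> ?thesis"
        then have H: "lam (Suc r) \<le> \<mu> r" "\<nu> r \<le> \<mu> r" "\<mu> (Suc r) \<le> \<nu> r" "\<mu> (Suc r) \<le> lam (Suc r)" if "r < Suc n" for r
          using that by blast+
        have Z: "\<mu> r = 0" "\<nu> r = 0" "\<mu> (Suc r) = 0" "lam (Suc r) = 0" if "\<not> r < Suc n" for r
          using that \<mu> assms by (auto simp: Y_def)
        have "\<nu> \<preceq> \<mu>" "\<mu> \<preceq> lam"
          unfolding interlaces_def
        proof safe
          fix i
          show "\<nu> i \<le> \<mu> i" "\<mu> (Suc i) \<le> \<nu> i" "lam (Suc i) \<le> \<mu> i"
            using H[of i] Z[of i] by (cases "i < Suc n"; simp)+
          show "\<mu> i \<le> lam i"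
            using \<mu> H[of "i - 1"] Z[of "i - 1"] by (cases i; cases "i - 1 < Suc n"; simp)
        qed
        with \<mu> show False by blast
      qed
      then have "(\<Prod>r<Suc n. column_weight (c (Suc r)) (d r) (lam (Suc r)) (\<nu> r) x y (\<mu> r) (\<mu> (Suc r))) = 0"
        by (intro prod_zero) (auto simp: column_weight_def)
      then show "?w \<mu> = 0" by simp
    qed
  qed
  finally have rhs: "?rhs = (\<Sum>\<mu> \<in> {\<mu> \<in> Y (Suc n). \<nu> \<preceq> \<mu> \<and> \<mu> \<preceq> lam}. ?w \<mu>)" .
  show ?thesis
    unfolding rhs sum_distrib_left
  proof (rule sum.cong[OF refl])
    fix \<mu> assume "\<mu> \<in> {\<mu> \<in> Y (Suc n). \<nu> \<preceq> \<mu> \<and> \<mu> \<preceq> lam}"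
    then have \<mu>: "\<mu> \<in> Y (Suc n)" "\<nu> \<preceq> \<mu>" "\<mu> \<preceq> lam" by auto
    define A where "A r = hpoch y (c r) (lam r - \<mu> r) / qfact (lam r - \<mu> r)" for r
    define B where "B r = hpoch 1 (y * d r) (\<mu> r - lam (Suc r)) / qfact (\<mu> r - lam (Suc r))" for r
    define P where "P r = hpoch x (c (Suc r)) (\<mu> r - \<nu> r) / qfact (\<mu> r - \<nu> r) *
       (hpoch 1 (x * d r) (\<nu> r - \<mu> (Suc r)) / qfact (\<nu> r - \<mu> (Suc r))) *
       (qfact (\<mu> r - \<mu> (Suc r)) / hpoch 1 (c (Suc r) * d r) (\<mu> r - \<mu> (Suc r)))" for r
    have B0: "B (Suc n) = 1"
      using \<mu>(1) by (simp add: B_def Y_def)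
    have 1: "row_weight (Suc n) (\<lambda>i. c (Suc i)) d \<mu> \<nu> x = (\<Prod>r<Suc n. P r)"
      unfolding row_weight_def by (rule prod.cong) (auto simp: P_def skew_coeff_def qpoch_eq_hpoch)
    have "row_weight (Suc (Suc n)) c d lam \<mu> y = (\<Prod>r<Suc (Suc n). A r * B r *
        (qfact (lam r - lam (Suc r)) / hpoch 1 (c r * d r) (lam r - lam (Suc r))))"
      unfolding row_weight_def by (rule prod.cong) (auto simp: A_def B_def skew_coeff_def qpoch_eq_hpoch)
    also have "\<dots> = (\<Prod>r<Suc (Suc n). A r) * (\<Prod>r<Suc (Suc n). B r) * ?K"
      by (simp only: prod.distrib)
    also have "(\<Prod>r<Suc (Suc n). A r) = A 0 * (\<Prod>r<Suc n. A (Suc r))"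
      by (rule prod.lessThan_Suc_shift)
    also have "(\<Prod>r<Suc (Suc n). B r) = (\<Prod>r<Suc n. B r)"
      using B0 by simp
    finally have 2: "row_weight (Suc (Suc n)) c d lam \<mu> y =
       A 0 * (\<Prod>r<Suc n. A (Suc r)) * (\<Prod>r<Suc n. B r) * ?K" .
    have 3: "(\<Prod>r<Suc n. column_weight (c (Suc r)) (d r) (lam (Suc r)) (\<nu> r) x y (\<mu> r) (\<mu> (Suc r))) =
       (\<Prod>r<Suc n. P r * A (Suc r) * B r)"
    proof (rule prod.cong[OF refl])
      fix r
      have "lam (Suc r) \<le> \<mu> r \<and> \<nu> r \<le> \<mu> r \<and> \<mu> (Suc r) \<le> \<nu> r \<and> \<mu> (Suc r) \<le> lam (Suc r)"
        using \<mu>(2,3) unfolding interlaces_def by blast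
      then show "column_weight (c (Suc r)) (d r) (lam (Suc r)) (\<nu> r) x y (\<mu> r) (\<mu> (Suc r)) = P r * A (Suc r) * B r"
        unfolding column_weight_def A_def B_def P_def by (simp only: simp_thms if_True mult_ac)
    qed
    have "?K * (A 0 * (\<Prod>r<Suc n. P r * A (Suc r) * B r)) =
       (\<Prod>r<Suc n. P r) * (A 0 * (\<Prod>r<Suc n. A (Suc r)) * (\<Prod>r<Suc n. B r) * ?K)"
      unfolding prod.distrib[of "\<lambda>r. P r * A (Suc r)" B] prod.distrib[of P "\<lambda>r. A (Suc r)"]
      by (simp only: mult_ac)
    then show "row_weight (Suc n) (\<lambda>i. c (Suc i)) d \<mu> \<nu> x * row_weight (Suc (Suc n)) c d lam \<mu> y = ?K * ?w \<mu>"
      unfolding 1 2 3 A_def[of 0, symmetric] by (rule sym)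
  qed
qed

lemma two_rows_symmetric:
  assumes "lam \<in> Y (Suc (Suc n))" "\<nu> \<in> Y n" "nonsingular (Suc (Suc n)) c d"
  shows "(\<Sum>\<mu> \<in> {\<mu> \<in> Y (Suc n). \<nu> \<preceq> \<mu> \<and> \<mu> \<preceq> lam}.
       row_weight (Suc n) (\<lambda>i. c (Suc i)) d \<mu> \<nu> x * row_weight (Suc (Suc n)) c d lam \<mu> y) =
     (\<Sum>\<mu> \<in> {\<mu> \<in> Y (Suc n). \<nu> \<preceq> \<mu> \<and> \<mu> \<preceq> lam}.
       row_weight (Suc n) (\<lambda>i. c (Suc i)) d \<mu> \<nu> y * row_weight (Suc (Suc n)) c d lam \<mu> x)"
  unfolding two_rows_eq_transfer[OF assms(1,2)]
  by (intro arg_cong2[of _ _ _ _ times] refl transfer_symmetric)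
     (use assms in \<open>auto simp: nonsingular_def Y_def\<close>)

lemma eval_at_spinW_two_rows:
  assumes v: "\<And>i. v i \<noteq> 0"
  shows "eval_at v (spinW q (Suc (Suc n)) c d lam) =
    (\<Sum>\<nu>\<in>{\<nu> \<in> Y n. \<nu> 0 \<le> lam 0}. eval_at v (spinW q n (\<lambda>i. c (Suc (Suc i))) d \<nu>) *
       (\<Sum>\<mu> \<in> {\<mu> \<in> Y (Suc n). \<nu> \<preceq> \<mu> \<and> \<mu> \<preceq> lam}.
       row_weight (Suc n) (\<lambda>i. c (Suc i)) d \<mu> \<nu> (v n) * row_weight (Suc (Suc n)) c d lam \<mu> (v (Suc n))))"
proof -
  let ?t = "\<lambda>\<mu> \<nu>. eval_at v (spinW q n (\<lambda>i. c (Suc (Suc i))) d \<nu>) *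
     (row_weight (Suc n) (\<lambda>i. c (Suc i)) d \<mu> \<nu> (v n) * row_weight (Suc (Suc n)) c d lam \<mu> (v (Suc n)))"
  let ?M = "{\<mu> \<in> Y (Suc n). \<mu> \<preceq> lam}" and ?N = "{\<nu> \<in> Y n. \<nu> 0 \<le> lam 0}"
  have "eval_at v (spinW q (Suc (Suc n)) c d lam) = (\<Sum>\<mu>\<in>?M. \<Sum>\<nu>\<in>{\<nu> \<in> Y n. \<nu> \<preceq> \<mu>}. ?t \<mu> \<nu>)"
    unfolding eval_at_spinW_Suc[OF v] sum_distrib_right by (simp only: mult.assoc)
  also have "\<dots> = (\<Sum>\<mu>\<in>?M. \<Sum>\<nu>\<in>{\<nu> \<in> ?N. \<nu> \<preceq> \<mu>}. ?t \<mu> \<nu>)"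
    by (intro sum.cong refl) (auto intro: order_trans[OF Y_interlaces_0 Y_interlaces_0])
  also have "\<dots> = (\<Sum>\<nu>\<in>?N. \<Sum>\<mu>\<in>{\<mu> \<in> ?M. \<nu> \<preceq> \<mu>}. ?t \<mu> \<nu>)"
    by (rule sum.swap_restrict) (auto intro: finite_interlacing finite_Y_bounded)
  also have "\<dots> = (\<Sum>\<nu>\<in>?N. \<Sum>\<mu>\<in>{\<mu> \<in> Y (Suc n). \<nu> \<preceq> \<mu> \<and> \<mu> \<preceq> lam}. ?t \<mu> \<nu>)"
    by (intro sum.cong refl) auto
  finally show ?thesis unfolding sum_distrib_left .
qed

lemma eval_at_spinW_cong:
  assumes "\<And>i. v i \<noteq> 0" "\<And>i. v' i \<noteq> 0" "\<And>i. i < n \<Longrightarrow> v i = v' i"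
  shows "eval_at v (spinW q n c d lam) = eval_at v' (spinW q n c d lam)"
  using assms(3)
proof (induction n arbitrary: c lam)
  case (Suc n)
  show ?case
    unfolding eval_at_spinW_Suc[OF assms(1)] eval_at_spinW_Suc[OF assms(2)] using Suc by simp
qed simp

lemma eval_at_spinW_adjacent_swap:
  assumes "\<And>i. v i \<noteq> 0" "lam \<in> Y n" "nonsingular n c d" "Suc k < n"
  shows "eval_at (v \<circ> transpose k (Suc k)) (spinW q n c d lam) = eval_at v (spinW q n c d lam)"
  using assms(2-4)
proof (induction n arbitrary: c lam)
  case (Suc n)
  have v': "(v \<circ> transpose k (Suc k)) i \<noteq> 0" for i using assms(1) by simp
  show ?case
  proof (cases "Suc k < n")
    case True
    show ?thesis
      unfolding eval_at_spinW_Suc[OF assms(1)] eval_at_spinW_Suc[of "v \<circ> transpose k (Suc k)", OF v']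
    proof (intro sum.cong refl arg_cong2[of _ _ _ _ times])
      show "eval_at (v \<circ> transpose k (Suc k)) (spinW q n (\<lambda>i. c (Suc i)) d \<mu>) = eval_at v (spinW q n (\<lambda>i. c (Suc i)) d \<mu>)"
        if "\<mu> \<in> {\<mu> \<in> Y n. \<mu> \<preceq> lam}" for \<mu>
        using that by (intro Suc.IH nonsingular_shift[OF Suc.prems(2)] True) simp
    qed (use True in \<open>simp add: transpose_def\<close>)
  next
    case False
    then have n: "n = Suc k" using Suc.prems by simp
    have "eval_at (v \<circ> transpose k (Suc k)) (spinW q k (\<lambda>i. c (Suc (Suc i))) d \<nu>) =
        eval_at v (spinW q k (\<lambda>i. c (Suc (Suc i))) d \<nu>)" for \<nu>
      by (rule eval_at_spinW_cong) (use assms(1) in \<open>auto simp: transpose_def\<close>)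
    then show ?thesis
      unfolding n eval_at_spinW_two_rows[OF assms(1)] eval_at_spinW_two_rows[of "v \<circ> transpose k (Suc k)", OF v']
      using Suc.prems two_rows_symmetric[of lam k _ c d "v k" "v (Suc k)"] unfolding n
      by (intro sum.cong refl) simp
  qed
qed simp

end

text \<open>
  Adjacent transpositions generate the symmetric group.
\<close>

lemma invariant_if_adjacent_swaps:
  fixes F :: "(nat \<Rightarrow> 'a) \<Rightarrow> 'b"
  assumes adj: "\<And>v k. P v \<Longrightarrow> Suc k < n \<Longrightarrow> F (v \<circ> transpose k (Suc k)) = F v"
    and P: "\<And>v \<pi>. P v \<Longrightarrow> P (v \<circ> \<pi>)"
    and "\<pi> permutes {..<n}" "P v"
  shows "F (v \<circ> \<pi>) = F v"
proof -
  have swap: "F (v \<circ> transpose i j) = F v" if "i < j" "j < n" "P v" for i j v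
    using that
  proof (induction j arbitrary: v)
    case (Suc j)
    show ?case
    proof (cases "i = j")
      case False
      then have ij: "i < j" using Suc.prems by simp
      let ?s = "transpose j (Suc j)"
      \<comment> \<open>conjugation by the transposition of \<open>j\<close> and \<open>j + 1\<close>\<close>
      have eq: "transpose i (Suc j) = ?s \<circ> transpose i j \<circ> ?s"
        using ij by (auto simp: fun_eq_iff transpose_def)
      have "F (v \<circ> transpose i (Suc j)) = F (v \<circ> ?s \<circ> transpose i j \<circ> ?s)"
        unfolding eq by (simp add: o_assoc)
      also have "\<dots> = F (v \<circ> ?s \<circ> transpose i j)"
        using Suc.prems by (intro adj P) auto
      also have "\<dots> = F (v \<circ> ?s)"
        using Suc.prems ij by (intro Suc.IH P) auto
      also have "\<dots> = F v"
        using Suc.prems by (intro adj) auto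
      finally show ?thesis .
    next
      case True
      show ?thesis
        unfolding True using Suc.prems by (intro adj) auto
    qed
  qed simp
  have swap': "F (v \<circ> transpose i j) = F v" if "i < n" "j < n" "P v" for i j v
    using swap[of i j v] swap[of j i v] that by (cases i j rule: linorder_cases) (auto simp: transpose_commute)
  have "\<forall>v. P v \<longrightarrow> F (v \<circ> \<pi>) = F v"
    using \<open>\<pi> permutes {..<n}\<close> finite_lessThan
  proof (induction rule: permutes_induct)
    case (swap a b p)
    show ?case
    proof (intro allI impI)
      fix v assume v: "P v"
      have "F (v \<circ> transpose a b \<circ> p) = F (v \<circ> transpose a b)"
        by (rule swap.IH[rule_format, OF P[OF v]])
      also have "\<dots> = F v"
        using swap.hyps by (intro swap' v) auto
      finally show "F (v \<circ> (transpose a b \<circ> p)) = F v"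
        by (simp only: o_assoc)
    qed
  qed simp
  then show ?thesis using \<open>P v\<close> by blast
qed

lemma polynomials_eq: "polynomials n = (\<Union>M. box (\<lambda>i. if i < n then M else 0))"
proof (intro subset_antisym subsetI)
  fix p assume p: "p \<in> polynomials n"
  define S where "S = (\<lambda>(m, i). nat (lookup m i)) ` (keys p \<times> {..<n})"
  have "p \<in> box (\<lambda>i. if i < n then Max S else 0)"
    unfolding box_def
  proof safe
    fix m i assume m: "m \<in> keys p"
    then show 0: "0 \<le> lookup m i" using p by (auto simp: polynomials_def)
    show "lookup m i \<le> int (if i < n then Max S else 0)"
    proof (cases "i < n")
      case True
      then have "nat (lookup m i) \<le> Max S"
        using m by (intro Max_ge) (auto simp: S_def)
      then show ?thesis using True 0 by simp
    next
      case False
      then have "i \<notin> keys m" using p m by (auto simp: polynomials_def)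
      then show ?thesis using False by (simp add: in_keys_iff)
    qed
  qed
  then show "p \<in> (\<Union>M. box (\<lambda>i. if i < n then M else 0))" by blast
next
  fix p assume "p \<in> (\<Union>M. box (\<lambda>i. if i < n then M else 0))"
  then obtain M where p: "p \<in> box (\<lambda>i. if i < n then M else 0)" by blast
  show "p \<in> polynomials n"
    unfolding polynomials_def
  proof safe
    fix m i assume m: "m \<in> keys p"
    show "0 \<le> lookup m i" using p m by (auto simp: box_def)
    assume "i \<in> keys m"
    moreover have "lookup m i = 0" if "\<not> i < n"
    proof -
      have "0 \<le> lookup m i \<and> lookup m i \<le> int (if i < n then M else 0)"
        using p m by (simp add: box_def)
      then show ?thesis using that by simp
    qed
    ultimately show "i < n" by (auto simp: in_keys_iff)
  qed
qed

lemma (in spin_whittaker) spinW_in_Sym: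
  assumes "lam \<in> Y n" "nonsingular n c d"
  shows "spinW q n c d lam \<in> Sym n"
proof -
  have "spinW q n c d lam \<in> polynomials n"
    using box_spinW[OF assms(1)] by (auto simp: polynomials_eq)
  moreover have "\<forall>m. lookup (spinW q n c d lam) (Poly_Mapping.map_key \<pi> m) = lookup (spinW q n c d lam) m"
    if "\<pi> permutes {..<n}" for \<pi>
    unfolding symmetric_iff_eval_at[OF permutes_bij[OF that]]
  proof (intro allI impI)
    fix v :: "nat \<Rightarrow> complex" assume v: "\<forall>i. v i \<noteq> 0"
    show "eval_at (v \<circ> \<pi>) (spinW q n c d lam) = eval_at v (spinW q n c d lam)"
    proof (rule invariant_if_adjacent_swaps[of "\<lambda>v. \<forall>i. v i \<noteq> 0" n "\<lambda>v. eval_at v (spinW q n c d lam)", OF _ _ that v])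
      show "eval_at (w \<circ> transpose k (Suc k)) (spinW q n c d lam) = eval_at w (spinW q n c d lam)"
        if "\<forall>i. w i \<noteq> 0" "Suc k < n" for w k
        using that by (intro eval_at_spinW_adjacent_swap[OF _ assms]) auto
    qed auto
  qed
  ultimately show ?thesis by (simp add: Sym_def)
qed

section \<open>Symmetric polynomials of bounded degree\<close>

lemma lookup_lscale: "lookup (lscale k p) m = k * lookup p m"
  unfolding lscale_def Const_def mult_map_scale_conv_mult[symmetric]
  by (simp add: Poly_Mapping.map.rep_eq when_def)

lemma zero_at_lscale: "zero_at v (lscale k p) = lscale k (zero_at v p)"
  by (rule poly_mapping_eqI) (simp add: lookup_zero_at lookup_lscale)

lemma eval_at_lscale: "(\<And>i. v i \<noteq> 0) \<Longrightarrow> eval_at v (lscale k p) = k * eval_at v p"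
  by (simp add: lscale_def eval_at_mult)

lemma box_lscale: "p \<in> box N \<Longrightarrow> lscale k p \<in> box N"
  using box_mult[OF box_Const[of k "\<lambda>_. 0"], of p N] by (simp add: lscale_def)

text \<open>
  Symmetric polynomials of degree at most \<open>N\<close> in each variable.  This is the filtration along which
  spanning is proved.
\<close>

definition Sym_le :: "nat \<Rightarrow> nat \<Rightarrow> laurent set" where
  "Sym_le n N = Sym n \<inter> box (\<lambda>i. if i < n then N else 0)"

lemma Sym_eq_Sym_le: "Sym n = (\<Union>N. Sym_le n N)"
  by (auto simp: Sym_le_def Sym_def polynomials_eq)

lemma Sym_le_iff: "p \<in> Sym_le n N \<longleftrightarrow> p \<in> box (\<lambda>i. if i < n then N else 0) \<and>
   (\<forall>\<pi> m. \<pi> permutes {..<n} \<longrightarrow> lookup p (Poly_Mapping.map_key \<pi> m) = lookup p m)"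
  by (auto simp: Sym_le_def Sym_def polynomials_eq)

lemma Sym_le_mono: "N \<le> M \<Longrightarrow> Sym_le n N \<subseteq> Sym_le n M"
  by (auto simp: Sym_le_iff elim!: box_mono)

lemma subspace_Sym_le: "laurent.subspace (Sym_le n N)"
  by (rule laurent.subspaceI) (auto simp: Sym_le_iff lookup_add lookup_lscale intro: box_add box_lscale)

lemma subspace_Sym: "laurent.subspace (Sym n)"
proof (rule laurent.subspaceI)
  fix p p' assume "p \<in> Sym n" "p' \<in> Sym n"
  then obtain N N' where "p \<in> Sym_le n N" "p' \<in> Sym_le n N'" by (auto simp: Sym_eq_Sym_le)
  then have "p \<in> Sym_le n (max N N')" "p' \<in> Sym_le n (max N N')"
    using Sym_le_mono[of N "max N N'" n] Sym_le_mono[of N' "max N N'" n] by auto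
  then show "p + p' \<in> Sym n"
    unfolding Sym_eq_Sym_le using laurent.subspace_add[OF subspace_Sym_le] by blast
next
  fix p k assume "p \<in> Sym n"
  then show "lscale k p \<in> Sym n"
    unfolding Sym_eq_Sym_le using laurent.subspace_scale[OF subspace_Sym_le] by blast
next
  show "0 \<in> Sym n"
    using laurent.subspace_0[OF subspace_Sym_le] by (auto simp: Sym_eq_Sym_le)
qed

lemma zero_at_Sym_le:
  assumes "p \<in> Sym_le (Suc n) N"
  shows "zero_at n p \<in> Sym_le n N"
  unfolding Sym_le_iff
proof (intro conjI allI impI)
  show "zero_at n p \<in> box (\<lambda>i. if i < n then N else 0)"
    unfolding box_def
  proof safe
    fix m i assume "m \<in> keys (zero_at n p)"
    then have m: "m \<in> keys p" "lookup m n = 0"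
      by (auto simp: in_keys_iff lookup_zero_at split: if_splits)
    have "0 \<le> lookup m i \<and> lookup m i \<le> int (if i < Suc n then N else 0)"
      using assms m(1) by (simp add: Sym_le_iff box_def)
    with m(2) show "0 \<le> lookup m i" "lookup m i \<le> int (if i < n then N else 0)"
      by (cases "i = n"; simp add: less_Suc_eq)+
  qed
  fix \<pi> m assume \<pi>: "\<pi> permutes {..<n}"
  then have "\<pi> permutes {..<Suc n}" "\<pi> n = n"
    by (auto intro: permutes_subset simp: permutes_not_in)
  then show "lookup (zero_at n p) (Poly_Mapping.map_key \<pi> m) = lookup (zero_at n p) m"
    using assms by (simp add: lookup_zero_at lookup_map_key permutes_inj Sym_le_iff)
qed

definition vars_prod :: "nat \<Rightarrow> laurent" where
  "vars_prod n = (\<Prod>i<n. X i)"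

definition vars_prod_inv :: "nat \<Rightarrow> laurent" where
  "vars_prod_inv n = (\<Prod>i<n. Xinv i)"

lemma vars_prod_mult_inv: "vars_prod n * (vars_prod_inv n * p) = p"
proof -
  have "vars_prod n * vars_prod_inv n = 1"
    by (simp add: vars_prod_def vars_prod_inv_def X_mult_Xinv flip: prod.distrib)
  then show ?thesis by (simp flip: mult.assoc)
qed

lemma vars_prod_cancel: "vars_prod n * p = vars_prod n * p' \<Longrightarrow> p = p'"
  by (metis vars_prod_mult_inv mult.left_commute)

lemma vars_prod_inv_eq: "vars_prod_inv n = single (\<Sum>i<n. single i (- 1)) 1"
  by (induction n) (simp_all add: vars_prod_inv_def Xinv_def mult_single)

text \<open>
  If the last variable divides every term, then by symmetry so does every other variable, hence
  their product does.
\<close>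

lemma symmetric_vanishing_divisible:
  assumes p: "p \<in> Sym_le (Suc n) N" and zero: "zero_at n p = 0"
  shows "vars_prod_inv (Suc n) * p \<in> Sym_le (Suc n) (N - 1)" "N = 0 \<Longrightarrow> p = 0"
proof -
  have pos: "1 \<le> lookup m i" "lookup m i \<le> int N" if m: "m \<in> keys p" and i: "i < Suc n" for m i
  proof -
    have perm: "transpose i n permutes {..<Suc n}"
      using i by (intro permutes_swap_id) auto
    have box: "0 \<le> lookup m i \<and> lookup m i \<le> int (if i < Suc n then N else 0)"
      using p m by (simp add: Sym_le_iff box_def)
    then show "lookup m i \<le> int N" using i by simp
    have "lookup m i \<noteq> 0"
    proof
      assume 0: "lookup m i = 0"
      let ?m = "Poly_Mapping.map_key (transpose i n) m"
      have "lookup ?m n = 0"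
        using 0 by (simp add: lookup_map_key)
      then have "lookup p ?m = lookup (zero_at n p) ?m"
        by (simp add: lookup_zero_at)
      moreover have "lookup p ?m = lookup p m"
        using p perm by (simp add: Sym_le_iff)
      ultimately show False
        using zero m by (simp add: in_keys_iff)
    qed
    with box show "1 \<le> lookup m i" by simp
  qed
  show "p = 0" if "N = 0"
    using pos[of _ 0] that keys_eq_empty[of p] by fastforce
  show "vars_prod_inv (Suc n) * p \<in> Sym_le (Suc n) (N - 1)"
    unfolding Sym_le_iff
  proof (intro conjI allI impI)
    show "vars_prod_inv (Suc n) * p \<in> box (\<lambda>i. if i < Suc n then N - 1 else 0)"
      unfolding box_def
    proof safe
      fix m i assume "m \<in> keys (vars_prod_inv (Suc n) * p)"
      then obtain b where b: "b \<in> keys p" and m: "m = (\<Sum>i<Suc n. single i (- 1)) + b"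
        using keys_mult[of "vars_prod_inv (Suc n)" p] unfolding vars_prod_inv_eq by auto
      have m: "lookup m i = (if i < Suc n then lookup b i - 1 else lookup b i)"
        unfolding m lookup_add lookup_sum lookup_single by (auto simp: when_def)
      have "0 \<le> lookup b i \<and> lookup b i \<le> int (if i < Suc n then N else 0)"
        using p b by (simp add: Sym_le_iff box_def)
      then show "0 \<le> lookup m i" "lookup m i \<le> int (if i < Suc n then N - 1 else 0)"
        using pos[OF b, of i] unfolding m by (cases "i < Suc n"; simp)+
    qed
    fix \<pi> m assume \<pi>: "\<pi> permutes {..<Suc n}"
    have "\<forall>m. lookup (vars_prod_inv (Suc n) * p) (Poly_Mapping.map_key \<pi> m) = lookup (vars_prod_inv (Suc n) * p) m"
      unfolding symmetric_iff_eval_at[OF permutes_bij[OF \<pi>]]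
    proof (intro allI impI)
      fix v :: "nat \<Rightarrow> complex" assume v: "\<forall>i. v i \<noteq> 0"
      have e: "eval_at w (vars_prod (Suc n)) = (\<Prod>i<Suc n. w i)" if "\<forall>i. w i \<noteq> 0" for w
        unfolding vars_prod_def using that by (subst eval_at_prod) auto
      have w: "eval_at w p = (\<Prod>i<Suc n. w i) * eval_at w (vars_prod_inv (Suc n) * p)" if "\<forall>i. w i \<noteq> 0" for w
      proof -
        have "eval_at w p = eval_at w (vars_prod (Suc n) * (vars_prod_inv (Suc n) * p))"
          by (simp only: vars_prod_mult_inv)
        also have "\<dots> = eval_at w (vars_prod (Suc n)) * eval_at w (vars_prod_inv (Suc n) * p)"
          using that by (intro eval_at_mult) auto
        finally show ?thesis using e[OF that] by simp
      qed
      have "\<forall>m. lookup p (Poly_Mapping.map_key \<pi> m) = lookup p m"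
        using p \<pi> by (simp add: Sym_le_iff)
      then have "eval_at (v \<circ> \<pi>) p = eval_at v p"
        using v symmetric_iff_eval_at[OF permutes_bij[OF \<pi>]] by blast
      moreover have "(\<Prod>i<Suc n. (v \<circ> \<pi>) i) = (\<Prod>i<Suc n. v i)"
        using prod.permute[OF \<pi>, of v] by simp
      moreover have "(\<Prod>i<Suc n. v i) \<noteq> 0"
        using v by simp
      ultimately show "eval_at (v \<circ> \<pi>) (vars_prod_inv (Suc n) * p) = eval_at v (vars_prod_inv (Suc n) * p)"
        using w[of v] w[of "v \<circ> \<pi>"] v by simp
    qed
    then show "lookup (vars_prod_inv (Suc n) * p) (Poly_Mapping.map_key \<pi> m) = lookup (vars_prod_inv (Suc n) * p) m"
      by blast
  qed
qed

section \<open>Adding a full column to a partition\<close>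

definition raise_parts :: "nat \<Rightarrow> (nat \<Rightarrow> nat) \<Rightarrow> nat \<Rightarrow> nat" where
  "raise_parts n lam i = (if i < n then Suc (lam i) else 0)"

definition lower_parts :: "(nat \<Rightarrow> nat) \<Rightarrow> nat \<Rightarrow> nat" where
  "lower_parts lam i = lam i - 1"

lemma raise_parts_in_Y: "lam \<in> Y n \<Longrightarrow> raise_parts n lam \<in> Y n"
  by (auto simp: Y_def raise_parts_def antimono_iff_le_Suc)

lemma lower_parts_in_Y: "lam \<in> Y n \<Longrightarrow> lower_parts lam \<in> Y n"
  by (auto simp: Y_def lower_parts_def antimono_iff_le_Suc diff_le_mono)

lemma lower_parts_raise_parts: "lam \<in> Y n \<Longrightarrow> lower_parts (raise_parts n lam) = lam"
  by (auto simp: Y_def lower_parts_def raise_parts_def fun_eq_iff)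

lemma raise_parts_lower_parts:
  assumes "lam \<in> Y n" "\<And>i. i < n \<Longrightarrow> lam i > 0"
  shows "raise_parts n (lower_parts lam) = lam"
proof
  fix i show "raise_parts n (lower_parts lam) i = lam i"
    using assms(2)[of i] assms(1) by (cases "i < n") (auto simp: raise_parts_def lower_parts_def Y_def)
qed

lemma interlaces_raise_parts:
  assumes "\<mu> \<in> Y n" "lam \<in> Y (Suc n)"
  shows "raise_parts n \<mu> \<preceq> raise_parts (Suc n) lam \<longleftrightarrow> \<mu> \<preceq> lam"
proof
  assume H: "raise_parts n \<mu> \<preceq> raise_parts (Suc n) lam"
  show "\<mu> \<preceq> lam"
    unfolding interlaces_def
  proof
    fix i
    have "raise_parts n \<mu> i \<le> raise_parts (Suc n) lam i \<and> raise_parts (Suc n) lam (Suc i) \<le> raise_parts n \<mu> i"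
      using H by (simp add: interlaces_def)
    then show "\<mu> i \<le> lam i \<and> lam (Suc i) \<le> \<mu> i"
      using assms by (cases "i < n") (auto simp: raise_parts_def Y_def)
  qed
next
  assume H: "\<mu> \<preceq> lam"
  show "raise_parts n \<mu> \<preceq> raise_parts (Suc n) lam"
    unfolding interlaces_def
  proof
    fix i
    show "raise_parts n \<mu> i \<le> raise_parts (Suc n) lam i \<and> raise_parts (Suc n) lam (Suc i) \<le> raise_parts n \<mu> i"
      using H by (auto simp: raise_parts_def interlaces_def)
  qed
qed

lemma spinW_skew_raise_parts:
  assumes "q_calculus q" "\<mu> \<in> Y n" "lam \<in> Y (Suc n)" "\<mu> \<preceq> lam" "c n = 0"
  shows "spinW_skew q (Suc n) c d (raise_parts (Suc n) lam) (raise_parts n \<mu>) v = X v * spinW_skew q (Suc n) c d lam \<mu> v"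
proof -
  interpret q_calculus q by fact
  have nz: "qpoch q q k \<noteq> 0" for k
    using qfact_nonzero[of k] by (simp add: hpoch_def qpoch_def)
  have le: "\<mu> r \<le> lam r" for r
    using assms(4) by (simp add: interlaces_def)
  have 0: "\<mu> n = 0" "lam (Suc n) = 0"
    using assms by (auto simp: Y_def)
  have inter: "raise_parts n \<mu> \<preceq> raise_parts (Suc n) lam"
    using assms interlaces_raise_parts by blast
  have last: "lin_c q v (c n) (raise_parts (Suc n) lam n - raise_parts n \<mu> n) = X v * lin_c q v (c n) (lam n - \<mu> n)"
     "lin_d q v (d n) (raise_parts n \<mu> n - raise_parts (Suc n) lam (Suc n)) = lin_d q v (d n) (\<mu> n - lam (Suc n))"
     "skew_coeff q c d (raise_parts (Suc n) lam) (raise_parts n \<mu>) n = skew_coeff q c d lam \<mu> n"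
    using assms(5) nz by (simp_all add: 0 raise_parts_def lin_c_def skew_coeff_def Let_def)
  have others: "(\<Prod>r<n. lin_c q v (c r) (raise_parts (Suc n) lam r - raise_parts n \<mu> r) *
        lin_d q v (d r) (raise_parts n \<mu> r - raise_parts (Suc n) lam (Suc r)) *
        Const (skew_coeff q c d (raise_parts (Suc n) lam) (raise_parts n \<mu>) r)) =
     (\<Prod>r<n. lin_c q v (c r) (lam r - \<mu> r) * lin_d q v (d r) (\<mu> r - lam (Suc r)) * Const (skew_coeff q c d lam \<mu> r))"
    by (rule prod.cong) (auto simp: raise_parts_def skew_coeff_def)
  show ?thesis
    unfolding spinW_skew_eq[OF inter] spinW_skew_eq[OF assms(4)] prod.lessThan_Suc last others
    by (simp only: mult_ac)
qed

text \<open>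
  The branching weights depend only on differences of parts, with the exception of the last
  part of \<open>\<lambda>\<close>.  When the last entry of \<open>c\<close> vanishes, that part enters only through a power of the
  variable of the row, so that raising it contributes one factor of this variable.
\<close>

lemma spinW_raise_parts:
  assumes "q_calculus q" "lam \<in> Y n" "n > 0 \<Longrightarrow> c (n - 1) = 0"
  shows "spinW q n c d (raise_parts n lam) = vars_prod n * spinW q n c d lam"
  using assms(2,3)
proof (induction n arbitrary: c lam)
  case 0
  then show ?case by (simp add: vars_prod_def)
next
  case (Suc n)
  have vars_prod: "vars_prod (Suc n) = vars_prod n * X n" by (simp add: vars_prod_def)
  have summand: "spinW q n (\<lambda>i. c (Suc i)) d (raise_parts n \<mu>) * spinW_skew q (Suc n) c d (raise_parts (Suc n) lam) (raise_parts n \<mu>) n =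
     vars_prod (Suc n) * (spinW q n (\<lambda>i. c (Suc i)) d \<mu> * spinW_skew q (Suc n) c d lam \<mu> n)"
    if "\<mu> \<in> Y n" "\<mu> \<preceq> lam" for \<mu>
  proof -
    have "spinW q n (\<lambda>i. c (Suc i)) d (raise_parts n \<mu>) = vars_prod n * spinW q n (\<lambda>i. c (Suc i)) d \<mu>"
      using that Suc.prems by (intro Suc.IH) (auto simp: Suc_diff_1)
    moreover have "spinW_skew q (Suc n) c d (raise_parts (Suc n) lam) (raise_parts n \<mu>) n = X n * spinW_skew q (Suc n) c d lam \<mu> n"
      using that Suc.prems assms(1) by (intro spinW_skew_raise_parts) auto
    ultimately show ?thesis
      by (simp only: vars_prod mult_ac)
  qed
  have pos: "\<mu> i > 0" if "\<mu> \<preceq> raise_parts (Suc n) lam" "i < n" for \<mu> i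
  proof -
    have "raise_parts (Suc n) lam (Suc i) \<le> \<mu> i"
      using that by (simp add: interlaces_def)
    then show ?thesis using that(2) by (simp add: raise_parts_def)
  qed
  have "spinW q (Suc n) c d (raise_parts (Suc n) lam) =
    (\<Sum>\<mu>\<in>{\<mu> \<in> Y n. \<mu> \<preceq> lam}. vars_prod (Suc n) * (spinW q n (\<lambda>i. c (Suc i)) d \<mu> * spinW_skew q (Suc n) c d lam \<mu> n))"
    unfolding spinW.simps
  proof (rule sum.reindex_bij_witness[of _ "raise_parts n" lower_parts], goal_cases)
    case (1 \<mu>)
    then show ?case using pos by (auto intro: raise_parts_lower_parts)
  next
    case (2 \<mu>)
    then have "raise_parts n (lower_parts \<mu>) = \<mu>" using pos by (auto intro: raise_parts_lower_parts)
    then show ?case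
      using 2 interlaces_raise_parts[OF lower_parts_in_Y Suc.prems(1), of \<mu>] lower_parts_in_Y by auto
  next
    case (3 \<mu>)
    then show ?case by (auto simp: lower_parts_raise_parts)
  next
    case (4 \<mu>)
    then show ?case using interlaces_raise_parts[OF _ Suc.prems(1)] raise_parts_in_Y by auto
  next
    case (5 \<mu>)
    then have "raise_parts n (lower_parts \<mu>) = \<mu>" using pos by (auto intro: raise_parts_lower_parts)
    then show ?case
      using 5 summand[of "lower_parts \<mu>"] interlaces_raise_parts[OF lower_parts_in_Y Suc.prems(1), of \<mu>] lower_parts_in_Y by auto
  qed
  then show ?case by (simp add: sum_distrib_left)
qed

section \<open>Restriction to the last variable zero\<close>

definition skew_at_0 :: "complex \<Rightarrow> nat \<Rightarrow> (nat \<Rightarrow> complex) \<Rightarrow> (nat \<Rightarrow> complex) \<Rightarrow> (nat \<Rightarrow> nat) \<Rightarrow> (nat \<Rightarrow> nat) \<Rightarrow> complex" where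
  "skew_at_0 q n c d lam \<mu> = (\<Prod>r<n. (\<Prod>i<lam r - \<mu> r. - (c r * q ^ i)) * skew_coeff q c d lam \<mu> r)"

lemma zero_at_lin_c: "zero_at v (lin_c q v c k) = Const (\<Prod>i<k. - (c * q ^ i))"
proof -
  have "zero_at v (lin_c q v c k) = (\<Prod>i<k. zero_at v (X v - Const (c * q ^ i)))"
    unfolding lin_c_def
    by (rule zero_at_prod[of _ _ "\<lambda>_ i. if i = v then 1 else 0"]) (intro box_diff box_X box_Const, simp)
  also have "\<dots> = Const (\<Prod>i<k. - (c * q ^ i))"
    unfolding Const_prod by (rule prod.cong) (use Const_diff[of 0] in auto)
  finally show ?thesis .
qed

lemma zero_at_lin_d: "zero_at v (lin_d q v d k) = 1"
proof -
  have X: "X v \<in> box (\<lambda>i. if i = v then 1 else 0)" by (rule box_X) simp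
  have b: "Const e * X v \<in> box (\<lambda>i. if i = v then 1 else 0)" for e
    using box_mult[OF box_Const[of e "\<lambda>_. 0"] X] by simp
  have z: "zero_at v (Const e * X v) = 0" for e
    by (subst zero_at_mult[OF box_Const X]) simp
  have "zero_at v (lin_d q v d k) = (\<Prod>i<k. zero_at v (1 - Const (d * q ^ i) * X v))"
    unfolding lin_d_def
    by (rule zero_at_prod[of _ _ "\<lambda>_ i. if i = v then 1 else 0"]) (intro box_diff box_1 b)
  then show ?thesis by (simp add: z)
qed

lemma zero_at_spinW_skew:
  assumes "\<mu> \<preceq> lam"
  shows "zero_at v (spinW_skew q n c d lam \<mu> v) = Const (skew_at_0 q n c d lam \<mu>)"
proof -
  have b: "lin_c q v (c r) (lam r - \<mu> r) * lin_d q v (d r) (\<mu> r - lam (Suc r)) \<in>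
      box (\<lambda>i. (if i = v then lam r - \<mu> r else 0) + (if i = v then \<mu> r - lam (Suc r) else 0))" for r
    by (intro box_mult box_lin_c box_lin_d)
  have z: "zero_at v (lin_c q v (c r) (lam r - \<mu> r) * lin_d q v (d r) (\<mu> r - lam (Suc r)) * Const (skew_coeff q c d lam \<mu> r))
      = Const ((\<Prod>i<lam r - \<mu> r. - (c r * q ^ i)) * skew_coeff q c d lam \<mu> r)" for r
    unfolding zero_at_mult[OF b box_Const[of _ "\<lambda>_. 0"]] zero_at_mult[OF box_lin_c box_lin_d]
    by (simp add: zero_at_lin_c zero_at_lin_d Const_mult)
  show ?thesis
    unfolding spinW_skew_eq[OF assms] skew_at_0_def Const_prod z[symmetric]
    by (rule zero_at_prod) (rule box_mult[OF b box_Const[of _ "\<lambda>_. 0"]])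
qed

text \<open>
  Only the last row of the branching rule contains the last variable; its weight is replaced by its
  value at \<open>0\<close>.
\<close>

lemma zero_at_spinW:
  assumes "lam \<in> Y (Suc n)"
  shows "zero_at n (spinW q (Suc n) c d lam) =
    (\<Sum>\<mu>\<in>{\<mu> \<in> Y n. \<mu> \<preceq> lam}. lscale (skew_at_0 q (Suc n) c d lam \<mu>) (spinW q n (\<lambda>i. c (Suc i)) d \<mu>))"
proof -
  have lam: "lam (Suc n) = 0" using assms by (simp add: Y_def)
  have "zero_at n (spinW q n (\<lambda>i. c (Suc i)) d \<mu> * spinW_skew q (Suc n) c d lam \<mu> n) =
     lscale (skew_at_0 q (Suc n) c d lam \<mu>) (spinW q n (\<lambda>i. c (Suc i)) d \<mu>)"
    if "\<mu> \<in> Y n" "\<mu> \<preceq> lam" for \<mu>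
  proof -
    have b: "spinW q n (\<lambda>i. c (Suc i)) d \<mu> \<in> box (\<lambda>i. if i < n then \<mu> 0 else 0)"
      using that by (intro box_spinW)
    show ?thesis
      unfolding zero_at_mult[OF b box_spinW_skew[OF that(2) lam]] zero_at_spinW_skew[OF that(2)] lscale_def
      using zero_at_id[OF b, of n] by (simp add: mult.commute)
  qed
  then show ?thesis
    by (simp del: lscale_def)
qed

context spin_whittaker
begin

lemma interlaces_refl: "lam \<in> Y n \<Longrightarrow> lam \<preceq> lam"
  by (auto simp: interlaces_def Y_def antimono_iff_le_Suc)

text \<open>
  For \<open>\<mu> = \<lambda>\<close> the product of the entries of \<open>c\<close> is empty, and the remaining factors are quotients
  of nonvanishing q-shifted factorials.
\<close>

lemma skew_at_0_diag:
  assumes "nonsingular n c d"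
  shows "skew_at_0 q n c d lam lam \<noteq> 0"
  using assms by (auto simp: skew_at_0_def skew_coeff_def qpoch_eq_hpoch nonsingular_def)

lemma interlaces_size_less:
  assumes "\<mu> \<in> Y n" "lam \<in> Y n" "\<mu> \<preceq> lam" "\<mu> \<noteq> lam"
  shows "(\<Sum>i<n. \<mu> i) < (\<Sum>i<n. lam i)"
proof (rule sum_strict_mono_ex1)
  show "\<forall>i\<in>{..<n}. \<mu> i \<le> lam i"
    using assms by (simp add: interlaces_def)
  obtain i where i: "\<mu> i \<noteq> lam i" using assms by blast
  then have "i < n"
    using assms(1,2) by (cases "i < n") (auto simp: Y_def)
  moreover have "\<mu> i < lam i"
    using i assms(3) by (auto simp: interlaces_def le_neq_implies_less)
  ultimately show "\<exists>i\<in>{..<n}. \<mu> i < lam i" by auto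
qed simp

section \<open>Independence and spanning\<close>

text \<open>
  The parameter sequences for which the polynomials \<open>spinW\<close> are of the form \<open>\<f>\<^sub>\<lambda>\<close>.  The condition is
  inherited by the polynomials in fewer variables, as the shift of \<open>c\<close> keeps its last entry.
\<close>

definition spinf_parameters :: "nat \<Rightarrow> (nat \<Rightarrow> complex) \<Rightarrow> (nat \<Rightarrow> complex) \<Rightarrow> bool" where
  "spinf_parameters n c d \<longleftrightarrow> nonsingular n c d \<and> (n > 0 \<longrightarrow> c (n - 1) = 0)"

lemma spinf_parameters_shift: "spinf_parameters (Suc n) c d \<Longrightarrow> spinf_parameters n (\<lambda>i. c (Suc i)) d"
  by (auto simp: spinf_parameters_def nonsingular_shift)

lemma skew_at_0_eq_0:
  assumes "spinf_parameters (Suc n) c d" "\<mu> \<in> Y n" "lam n > 0"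
  shows "skew_at_0 q (Suc n) c d lam \<mu> = 0"
proof -
  have "(\<Prod>i<lam n - \<mu> n. - (c n * q ^ i)) = 0"
    using assms by (intro prod_zero) (auto simp: spinf_parameters_def Y_def)
  then show ?thesis by (simp add: skew_at_0_def)
qed

text \<open>
  One descent step for independence: the coefficients of the partitions with \<open>lam n = 0\<close> vanish.
  Setting the last variable to zero leaves a relation between the polynomials in \<open>n\<close> variables,
  and for a partition of maximal size among those with nonzero coefficient only the diagonal
  term contributes.
\<close>

lemma spinW_coefficient_zero_if_last_part_zero:
  assumes spinf_parameters: "spinf_parameters (Suc n) c d"
    and IH: "\<And>u A \<mu>. finite A \<Longrightarrow> A \<subseteq> Y n \<Longrightarrow>
      (\<Sum>\<mu>\<in>A. lscale (u \<mu>) (spinW q n (\<lambda>i. c (Suc i)) d \<mu>)) = 0 \<Longrightarrow> \<mu> \<in> A \<Longrightarrow> u \<mu> = 0"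
    and "finite A" "A \<subseteq> Y (Suc n)" "(\<Sum>lam\<in>A. lscale (u lam) (spinW q (Suc n) c d lam)) = 0"
    and "lam \<in> A" "lam n = 0"
  shows "u lam = 0"
proof (rule ccontr)
  assume "u lam \<noteq> 0"
  define B where "B = {lam \<in> A. lam n = 0}"
  define t where "t = skew_at_0 q (Suc n) c d"
  define f where "f = spinW q n (\<lambda>i. c (Suc i)) d"
  define U where "U = {lam \<in> B. u lam \<noteq> 0}"
  have finB: "finite B" and finU: "finite U" and "U \<noteq> {}"
    using assms \<open>u lam \<noteq> 0\<close> by (auto simp: B_def U_def)
  \<comment> \<open>partitions with at most \<open>n\<close> parts, among those with at most \<open>n + 1\<close>\<close>
  have BY: "B \<subseteq> Y n"
  proof
    fix lam assume "lam \<in> B"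
    then have lam: "lam \<in> Y (Suc n)" "lam n = 0" using assms(4) by (auto simp: B_def)
    have "lam i = 0" if "n \<le> i" for i
      using lam that by (cases "i = n") (auto simp: Y_def)
    then show "lam \<in> Y n" using lam(1) by (simp add: Y_def)
  qed
  define size where "size lam = (\<Sum>i<n. lam i)" for lam :: "nat \<Rightarrow> nat"
  have "Max (size ` U) \<in> size ` U"
    using finU \<open>U \<noteq> {}\<close> by (intro Max_in) auto
  then obtain top where "top \<in> U" "size top = Max (size ` U)" by auto
  then have top: "top \<in> U" "lam \<in> U \<Longrightarrow> size lam \<le> size top" for lam
    using finU by auto
  define M where "M = (\<Union>lam\<in>B. {\<mu> \<in> Y n. \<mu> \<preceq> lam})"
  have finM: "finite M"
    unfolding M_def using finB finite_interlacing by blast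
  have "0 = zero_at n (\<Sum>lam\<in>A. lscale (u lam) (spinW q (Suc n) c d lam))"
    using assms(5) by simp
  also have "\<dots> = (\<Sum>lam\<in>A. \<Sum>\<mu>\<in>{\<mu> \<in> Y n. \<mu> \<preceq> lam}. lscale (u lam * t lam \<mu>) (f \<mu>))"
    unfolding zero_at_sum zero_at_lscale t_def f_def
  proof (rule sum.cong[OF refl])
    fix lam assume "lam \<in> A"
    then have "lam \<in> Y (Suc n)" using assms(4) by blast
    show "lscale (u lam) (zero_at n (spinW q (Suc n) c d lam)) =
      (\<Sum>\<mu>\<in>{\<mu> \<in> Y n. \<mu> \<preceq> lam}. lscale (u lam * skew_at_0 q (Suc n) c d lam \<mu>) (spinW q n (\<lambda>i. c (Suc i)) d \<mu>))"
      unfolding zero_at_spinW[OF \<open>lam \<in> Y (Suc n)\<close>] laurent.scale_sum_right laurent.scale_scale ..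
  qed
  also have "\<dots> = (\<Sum>lam\<in>B. \<Sum>\<mu>\<in>{\<mu> \<in> Y n. \<mu> \<preceq> lam}. lscale (u lam * t lam \<mu>) (f \<mu>))"
  proof (rule sum.mono_neutral_right[OF assms(3)])
    show "\<forall>lam\<in>A - B. (\<Sum>\<mu>\<in>{\<mu> \<in> Y n. \<mu> \<preceq> lam}. lscale (u lam * t lam \<mu>) (f \<mu>)) = 0"
      using skew_at_0_eq_0[OF spinf_parameters] by (auto simp: B_def t_def intro!: sum.neutral)
  qed (auto simp: B_def)
  also have "\<dots> = (\<Sum>lam\<in>B. \<Sum>\<mu>\<in>{\<mu> \<in> M. \<mu> \<preceq> lam}. lscale (u lam * t lam \<mu>) (f \<mu>))"
    by (intro sum.cong refl) (auto simp: M_def)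
  also have "\<dots> = (\<Sum>\<mu>\<in>M. \<Sum>lam\<in>{lam \<in> B. \<mu> \<preceq> lam}. lscale (u lam * t lam \<mu>) (f \<mu>))"
    by (rule sum.swap_restrict[OF finB finM])
  also have "\<dots> = (\<Sum>\<mu>\<in>M. lscale (\<Sum>lam\<in>{lam \<in> B. \<mu> \<preceq> lam}. u lam * t lam \<mu>) (f \<mu>))"
    by (simp only: laurent.scale_sum_left)
  finally have sum0: "(\<Sum>\<mu>\<in>M. lscale (\<Sum>lam\<in>{lam \<in> B. \<mu> \<preceq> lam}. u lam * t lam \<mu>) (f \<mu>)) = 0" ..
  have topB: "top \<in> B" "u top \<noteq> 0" and topY: "top \<in> Y n"
    using top(1) BY by (auto simp: U_def)
  then have "top \<in> M"
    using interlaces_refl[OF topY] by (auto simp: M_def)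
  have "(\<Sum>lam\<in>{lam \<in> B. top \<preceq> lam}. u lam * t lam top) = 0"
    by (rule IH[OF finM _ sum0[unfolded f_def] \<open>top \<in> M\<close>]) (auto simp: M_def)
  moreover have "(\<Sum>lam\<in>{lam \<in> B. top \<preceq> lam}. u lam * t lam top) = (\<Sum>lam\<in>{top}. u lam * t lam top)"
  proof (rule sum.mono_neutral_right)
    show "\<forall>lam\<in>{lam \<in> B. top \<preceq> lam} - {top}. u lam * t lam top = 0"
    proof
      fix lam assume lam: "lam \<in> {lam \<in> B. top \<preceq> lam} - {top}"
      then have "size top < size lam"
        unfolding size_def using topY BY by (intro interlaces_size_less) auto
      then have "lam \<notin> U" using top(2)[of lam] by auto
      then show "u lam * t lam top = 0" using lam by (auto simp: U_def)
    qed
  qed (use finB topB interlaces_refl[OF topY] in auto)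
  ultimately show False
    using topB skew_at_0_diag[of "Suc n" c d top] spinf_parameters by (auto simp: t_def spinf_parameters_def)
qed

text \<open>
  After the partitions with last part \<open>0\<close> have been removed, the product of all variables can
  be cancelled, which lowers all parts by one.
\<close>

lemma spinW_independent:
  assumes "spinf_parameters n c d" "finite A" "A \<subseteq> Y n"
    "(\<Sum>lam\<in>A. lscale (u lam) (spinW q n c d lam)) = 0" "lam \<in> A"
  shows "u lam = 0"
  using assms
proof (induction n arbitrary: c A u lam)
  case 0
  then have "A = {\<lambda>_. 0}" "lam = (\<lambda>_. 0)" by (auto simp: Y_0)
  then have "lscale (u lam) 1 = 0" using 0 by simp
  then have "eval_at (\<lambda>_. 1) (lscale (u lam) 1) = 0" by simp
  then show ?case by (simp add: eval_at_lscale)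
next
  case (Suc n)
  note spinf_parameters = Suc.prems(1)
  note IH_n = Suc.IH[OF spinf_parameters_shift[OF spinf_parameters]]
  \<comment> \<open>Induction on a strict bound \<open>M\<close> for the smallest parts.\<close>
  have main: "u lam = 0"
    if "finite A" "A \<subseteq> Y (Suc n)" "\<forall>lam\<in>A. lam n < M"
      "(\<Sum>lam\<in>A. lscale (u lam) (spinW q (Suc n) c d lam)) = 0" "lam \<in> A" for A u lam M
    using that
  proof (induction M arbitrary: A u lam)
    case (Suc M)
    note A = Suc.prems(1-3) and sum0 = Suc.prems(4) and lam = Suc.prems(5)
    define C where "C = {lam \<in> A. lam n > 0}"
    have B: "u lam = 0" if "lam \<in> A" "lam n = 0" for lam
      by (rule spinW_coefficient_zero_if_last_part_zero[OF spinf_parameters _ A(1,2) sum0 that]) (rule IH_n)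
    have CY: "C \<subseteq> Y (Suc n)" and finC: "finite C" using A by (auto simp: C_def)
    have rl: "raise_parts (Suc n) (lower_parts lam) = lam" if "lam \<in> C" for lam
    proof (rule raise_parts_lower_parts)
      show "lam \<in> Y (Suc n)" using that CY by blast
      then have "lam n \<le> lam i" if "i < Suc n" for i
        using that by (auto simp: Y_def intro: antimonoD)
      then show "0 < lam i" if "i < Suc n" for i
        using \<open>lam \<in> C\<close> that by (force simp: C_def)
    qed
    have inj: "inj_on lower_parts C"
      by (rule inj_on_inverseI[of _ "raise_parts (Suc n)"]) (rule rl)
    have "vars_prod (Suc n) * (\<Sum>lam\<in>lower_parts ` C. lscale (u (raise_parts (Suc n) lam)) (spinW q (Suc n) c d lam)) =
       (\<Sum>lam\<in>C. lscale (u lam) (vars_prod (Suc n) * spinW q (Suc n) c d (lower_parts lam)))"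
      unfolding sum_distrib_left sum.reindex[OF inj] by (simp add: rl lscale_def mult_ac)
    also have "\<dots> = (\<Sum>lam\<in>C. lscale (u lam) (spinW q (Suc n) c d lam))"
    proof (rule sum.cong[OF refl])
      fix lam assume lam: "lam \<in> C"
      have "spinW q (Suc n) c d (raise_parts (Suc n) (lower_parts lam)) = vars_prod (Suc n) * spinW q (Suc n) c d (lower_parts lam)"
        using CY lam spinf_parameters by (intro spinW_raise_parts lower_parts_in_Y q_calculus_axioms) (auto simp: spinf_parameters_def)
      then show "lscale (u lam) (vars_prod (Suc n) * spinW q (Suc n) c d (lower_parts lam)) = lscale (u lam) (spinW q (Suc n) c d lam)"
        by (simp only: rl[OF lam])
    qed
    also have "\<dots> = (\<Sum>lam\<in>A. lscale (u lam) (spinW q (Suc n) c d lam))"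
      using A(1) B by (intro sum.mono_neutral_left) (auto simp: C_def)
    finally have "vars_prod (Suc n) * (\<Sum>lam\<in>lower_parts ` C. lscale (u (raise_parts (Suc n) lam)) (spinW q (Suc n) c d lam)) =
        vars_prod (Suc n) * 0"
      unfolding sum0 mult_zero_right .
    then have lower0: "(\<Sum>lam\<in>lower_parts ` C. lscale (u (raise_parts (Suc n) lam)) (spinW q (Suc n) c d lam)) = 0"
      by (rule vars_prod_cancel)
    have lower_parts: "finite (lower_parts ` C)" "lower_parts ` C \<subseteq> Y (Suc n)" "\<forall>lam\<in>lower_parts ` C. lam n < M"
      using finC CY lower_parts_in_Y A(3) by (auto simp: C_def lower_parts_def)
    have C: "u (raise_parts (Suc n) lam) = 0" if "lam \<in> lower_parts ` C" for lam
      by (rule Suc.IH[OF lower_parts lower0 that])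
    show "u lam = 0"
    proof (cases "lam n = 0")
      case False
      then have "lam \<in> C" using lam by (simp add: C_def)
      then show ?thesis using C[of "lower_parts lam"] rl by simp
    qed (use B lam in blast)
  qed auto
  have bound: "\<forall>lam\<in>A. lam n < Suc (Max ((\<lambda>lam. lam n) ` A))"
    using Suc.prems(2) by (auto simp: less_Suc_eq_le)
  show ?case
    by (rule main[OF Suc.prems(2,3) bound Suc.prems(4,5)])
qed

lemma spinW_in_Sym_le:
  assumes "spinf_parameters n c d" "lam \<in> Y n" "lam 0 \<le> N"
  shows "spinW q n c d lam \<in> Sym_le n N"
  using assms spinW_in_Sym[of lam n c d] box_mono[OF box_spinW[OF assms(2)], of "\<lambda>i. if i < n then N else 0"]
  by (auto simp: Sym_le_def spinf_parameters_def)

text \<open>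
  Spanning, refined by degree: the bound \<open>N\<close> is the same for the polynomials and for the
  largest part.  The refinement guarantees that each division by the product of the variables
  lowers \<open>N\<close>.
\<close>

lemma Sym_le_subset_span:
  assumes "spinf_parameters n c d" "p \<in> Sym_le n N"
  shows "p \<in> laurent.span (spinW q n c d ` {lam \<in> Y n. lam 0 \<le> N})"
  using assms
proof (induction n arbitrary: c N p)
  case 0
  have "keys p \<subseteq> {0}"
  proof
    fix m assume "m \<in> keys p"
    then have "\<forall>i. lookup m i = 0" using 0 by (auto simp: Sym_le_def box_def intro: antisym)
    then show "m \<in> {0}" by (auto intro: poly_mapping_eqI)
  qed
  then have "p = (\<Sum>m\<in>{0}. single m (lookup p m))"
    by (intro poly_mapping_expand) simp_all
  also have "(\<Sum>m\<in>{0}. single m (lookup p m)) = lscale (lookup p 0) (spinW q 0 c d (\<lambda>_. 0))"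
    by (simp add: lscale_def Const_def)
  also have "\<dots> \<in> laurent.span (spinW q 0 c d ` {lam \<in> Y 0. lam 0 \<le> N})"
    by (intro laurent.span_scale laurent.span_base) (auto simp: Y_0)
  finally show ?case .
next
  case (Suc n)
  define c' where "c' = (\<lambda>i. c (Suc i))"
  define F where "F N = spinW q (Suc n) c d ` {lam \<in> Y (Suc n). lam 0 \<le> N}" for N
  define R where "R N = zero_at n ` laurent.span (F N)" for N
  note pr = Suc.prems(1)
  have subspace_R: "laurent.subspace (R N)" for N
  proof (rule laurent.subspaceI)
    show "0 \<in> R N"
      unfolding R_def using laurent.span_zero by (metis image_eqI zero_at_0)
  next
    fix x y assume "x \<in> R N" "y \<in> R N"
    then show "x + y \<in> R N"
      unfolding R_def using laurent.span_add by (auto simp flip: zero_at_add)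
  next
    fix k x assume "x \<in> R N"
    then show "lscale k x \<in> R N"
      unfolding R_def using laurent.span_scale by (auto simp flip: zero_at_lscale)
  qed
  \<comment> \<open>Inverting the triangular system, by induction on the size of \<open>\<mu>\<close>.\<close>
  have gen: "spinW q n c' d \<mu> \<in> R N" if "\<mu> \<in> Y n" "\<mu> 0 \<le> N" for \<mu> N
    using that
  proof (induction "\<Sum>i<n. \<mu> i" arbitrary: \<mu> rule: less_induct)
    case (less \<mu>)
    have Y: "\<mu> \<in> Y (Suc n)" using less.prems by (auto simp: Y_def)
    let ?t = "skew_at_0 q (Suc n) c d \<mu>" and ?f = "spinW q n c' d"
    have t: "?t \<mu> \<noteq> 0" using skew_at_0_diag pr by (simp add: spinf_parameters_def)
    have "zero_at n (spinW q (Suc n) c d \<mu>) = (\<Sum>\<nu>\<in>{\<nu> \<in> Y n. \<nu> \<preceq> \<mu>}. lscale (?t \<nu>) (?f \<nu>))"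
      unfolding c'_def by (rule zero_at_spinW[OF Y])
    also have "\<dots> = lscale (?t \<mu>) (?f \<mu>) + (\<Sum>\<nu>\<in>{\<nu> \<in> Y n. \<nu> \<preceq> \<mu>} - {\<mu>}. lscale (?t \<nu>) (?f \<nu>))"
      using less.prems interlaces_refl by (intro sum.remove finite_interlacing) auto
    finally have f: "?f \<mu> = lscale (1 / ?t \<mu>) (zero_at n (spinW q (Suc n) c d \<mu>) -
       (\<Sum>\<nu>\<in>{\<nu> \<in> Y n. \<nu> \<preceq> \<mu>} - {\<mu>}. lscale (?t \<nu>) (?f \<nu>)))"
      using t by (simp add: laurent.scale_scale)
    have "zero_at n (spinW q (Suc n) c d \<mu>) \<in> R N"
      unfolding R_def F_def using Y less.prems by (intro imageI laurent.span_base) auto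
    moreover have "(\<Sum>\<nu>\<in>{\<nu> \<in> Y n. \<nu> \<preceq> \<mu>} - {\<mu>}. lscale (?t \<nu>) (?f \<nu>)) \<in> R N"
    proof (intro laurent.subspace_sum[OF subspace_R] laurent.subspace_scale[OF subspace_R])
      fix \<nu> assume \<nu>: "\<nu> \<in> {\<nu> \<in> Y n. \<nu> \<preceq> \<mu>} - {\<mu>}"
      show "?f \<nu> \<in> R N"
      proof (rule less.hyps)
        show "(\<Sum>i<n. \<nu> i) < (\<Sum>i<n. \<mu> i)"
          using \<nu> less.prems by (intro interlaces_size_less) auto
        show "\<nu> \<in> Y n" using \<nu> by blast
        show "\<nu> 0 \<le> N" using \<nu> less.prems Y_interlaces_0[of \<nu> \<mu>] by auto
      qed
    qed
    ultimately show ?case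
      by (subst f) (intro laurent.subspace_scale[OF subspace_R] laurent.subspace_diff[OF subspace_R])
  qed
  have F_Sym_le: "laurent.span (F N) \<subseteq> Sym_le (Suc n) N" for N
    by (rule laurent.span_minimal[OF _ subspace_Sym_le]) (auto simp: F_def simp del: spinW.simps intro: spinW_in_Sym_le[OF pr])
  have approx: "\<exists>p'\<in>laurent.span (F N). zero_at n p' = zero_at n p" if "p \<in> Sym_le (Suc n) N" for p N
  proof -
    have "zero_at n p \<in> laurent.span (spinW q n c' d ` {\<mu> \<in> Y n. \<mu> 0 \<le> N})"
      unfolding c'_def by (rule Suc.IH[OF spinf_parameters_shift[OF pr] zero_at_Sym_le[OF that]])
    also have "\<dots> \<subseteq> R N"
      by (rule laurent.span_minimal[OF _ subspace_R]) (use gen in blast)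
    finally show ?thesis unfolding R_def by auto
  qed
  have vars_prod_F: "vars_prod (Suc n) * r \<in> laurent.span (F (Suc N))" if "r \<in> laurent.span (F N)" for r N
    using that
  proof (induction rule: laurent.span_induct_alt)
    case base
    show ?case using laurent.span_zero by simp
  next
    case (step k x y)
    obtain lam where lam: "lam \<in> Y (Suc n)" "lam 0 \<le> N" and x: "x = spinW q (Suc n) c d lam"
      using step.hyps by (auto simp: F_def)
    have "vars_prod (Suc n) * x = spinW q (Suc n) c d (raise_parts (Suc n) lam)"
      unfolding x using lam pr by (intro spinW_raise_parts[symmetric] q_calculus_axioms) (auto simp: spinf_parameters_def)
    also have "\<dots> \<in> laurent.span (F (Suc N))"
      unfolding F_def using raise_parts_in_Y[OF lam(1)] lam(2) by (intro laurent.span_base imageI) (auto simp: raise_parts_def[of _ _ 0])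
    finally have "lscale k (vars_prod (Suc n) * x) + vars_prod (Suc n) * y \<in> laurent.span (F (Suc N))"
      using step by (intro laurent.span_add laurent.span_scale) auto
    moreover have "vars_prod (Suc n) * (lscale k x + y) = lscale k (vars_prod (Suc n) * x) + vars_prod (Suc n) * y"
      unfolding lscale_def by (simp add: distrib_left mult.left_commute)
    ultimately show ?case by (simp only:)
  qed
  have "p \<in> laurent.span (F N)" if "p \<in> Sym_le (Suc n) N" for p N
    using that
  proof (induction N arbitrary: p)
    case 0
    obtain p' where p': "p' \<in> laurent.span (F 0)" "zero_at n p' = zero_at n p"
      using approx[OF 0] by blast
    have "p - p' \<in> Sym_le (Suc n) 0"
      using 0 p'(1) F_Sym_le by (intro laurent.subspace_diff[OF subspace_Sym_le]) auto
    then have "p - p' = 0"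
      by (rule symmetric_vanishing_divisible(2)[OF _ _ refl]) (simp add: p')
    then show ?case using p' by simp
  next
    case (Suc N)
    obtain p' where p': "p' \<in> laurent.span (F (Suc N))" "zero_at n p' = zero_at n p"
      using approx[OF Suc.prems] by blast
    have "p - p' \<in> Sym_le (Suc n) (Suc N)"
      using Suc.prems p'(1) F_Sym_le by (intro laurent.subspace_diff[OF subspace_Sym_le]) auto
    then have "vars_prod_inv (Suc n) * (p - p') \<in> Sym_le (Suc n) (Suc N - 1)"
      by (rule symmetric_vanishing_divisible(1)) (simp add: p')
    then have "vars_prod (Suc n) * (vars_prod_inv (Suc n) * (p - p')) \<in> laurent.span (F (Suc N))"
      using Suc.IH by (intro vars_prod_F) simp
    then have "p - p' + p' \<in> laurent.span (F (Suc N))"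
      unfolding vars_prod_mult_inv using p' by (intro laurent.span_add)
    then show ?case by simp
  qed
  then show ?case using Suc.prems unfolding F_def by blast
qed

lemma spinW_basis:
  assumes "spinf_parameters n c d"
  shows "inj_on (spinW q n c d) (Y n)" "laurent.independent (spinW q n c d ` Y n)"
    "laurent.span (spinW q n c d ` Y n) = Sym n"
proof -
  show inj: "inj_on (spinW q n c d) (Y n)"
  proof (rule inj_onI, rule ccontr)
    fix lam \<mu> assume *: "lam \<in> Y n" "\<mu> \<in> Y n" "spinW q n c d lam = spinW q n c d \<mu>" "lam \<noteq> \<mu>"
    let ?u = "\<lambda>\<nu>. if \<nu> = lam then 1 else - 1 :: complex"
    have "?u lam = 0"
      by (rule spinW_independent[OF assms, of "{lam, \<mu>}" ?u]) (use * in auto)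
    then show False by simp
  qed
  show "laurent.independent (spinW q n c d ` Y n)"
    unfolding laurent.independent_explicit_finite_subsets
  proof (intro allI impI ballI)
    fix S u p assume S: "S \<subseteq> spinW q n c d ` Y n" "finite S" "(\<Sum>p\<in>S. lscale (u p) p) = 0" "p \<in> S"
    obtain A where A: "A \<subseteq> Y n" "S = spinW q n c d ` A" "inj_on (spinW q n c d) A"
      using S(1) inj by (meson inj_on_subset subset_imageE)
    have "finite A" using A S(2) finite_imageD by blast
    obtain lam where lam: "lam \<in> A" "p = spinW q n c d lam" using S(4) A by blast
    have "(\<Sum>lam\<in>A. lscale (u (spinW q n c d lam)) (spinW q n c d lam)) = 0"
      using S(3) unfolding A(2) sum.reindex[OF A(3)] by (simp add: o_def)
    from spinW_independent[OF assms \<open>finite A\<close> A(1) this lam(1)] show "u p = 0"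
      unfolding lam(2) .
  qed
  show "laurent.span (spinW q n c d ` Y n) = Sym n"
  proof (rule subset_antisym)
    show "laurent.span (spinW q n c d ` Y n) \<subseteq> Sym n"
      by (rule laurent.span_minimal[OF _ subspace_Sym])
         (use assms spinW_in_Sym in \<open>auto simp: spinf_parameters_def\<close>)
    show "Sym n \<subseteq> laurent.span (spinW q n c d ` Y n)"
    proof
      fix p assume "p \<in> Sym n"
      then obtain N where "p \<in> Sym_le n N" by (auto simp: Sym_eq_Sym_le)
      then have "p \<in> laurent.span (spinW q n c d ` {lam \<in> Y n. lam 0 \<le> N})"
        by (rule Sym_le_subset_span[OF assms])
      also have "\<dots> \<subseteq> laurent.span (spinW q n c d ` Y n)"
        by (intro laurent.span_mono image_mono) auto
      finally show "p \<in> laurent.span (spinW q n c d ` Y n)" .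
    qed
  qed
qed

lemma hpoch_nonzero: "norm z < 1 \<Longrightarrow> hpoch 1 z k \<noteq> 0"
proof -
  assume z: "norm z < 1"
  have "1 - z * q ^ i \<noteq> 0" for i
  proof
    assume "1 - z * q ^ i = 0"
    then have "norm (z * q ^ i) = 1" by simp
    moreover have "norm (z * q ^ i) \<le> norm z * 1"
      unfolding norm_mult norm_power using norm_q by (intro mult_left_mono power_le_one) auto
    ultimately show False using z by simp
  qed
  then show ?thesis by (simp add: hpoch_def)
qed

end

theorem theorem1p2:
  fixes q :: complex and n :: nat and a b :: "nat \<Rightarrow> complex"
  assumes "norm q < 1"
    and "\<And>i. i < n - 1 \<Longrightarrow> norm (a i) < 1"
    and "\<And>i. i < n - 1 \<Longrightarrow> norm (b i) < 1"
  shows "inj_on (spinf q n a b) (Y n) \<and>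
         laurent.independent (spinf q n a b ` Y n) \<and>
         laurent.span (spinf q n a b ` Y n) = Sym n"
proof -
  interpret spin_whittaker q by unfold_locales fact
  have "hpoch 1 ((a(n - 1 := 0)) i * b j) k \<noteq> 0" if "i < n" "j \<le> i" for i j k
  proof (cases "i = n - 1")
    case True
    then show ?thesis by (simp add: hpoch_def)
  next
    case False
    then have "norm (a i) < 1" "norm (b j) < 1" using that assms by auto
    then have "norm (a i) * norm (b j) < 1 * 1"
      by (intro mult_strict_mono') auto
    then show ?thesis using False by (intro hpoch_nonzero) (simp add: norm_mult)
  qed
  then have "spinf_parameters n (a(n - 1 := 0)) b"
    by (auto simp: spinf_parameters_def nonsingular_def)
  from spinW_basis[OF this] show ?thesis
    unfolding spinf_def[abs_def] by blast
qed

end
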